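(* Fix hyperparameters $\vartheta=(\theta,\sigma^2,\boldsymbol\mu_\kappa,\boldsymbol\Sigma_\kappa)$ with $\sigma^2>0$. Let $Y=(Y_1,\ldots,Y_n)^\top$ with $Y_i=f_0(x_i)+\epsilon_i$ at fixed points $x_1,\ldots,x_n\in[t_0,t_1]$, where the $\epsilon_i$ are independent $N(0,\sigma^2)$ and independent of the Gaussian differential ensemble $(f_{-r},\ldots,f_r)$, and let $G\in\mathbb R^d$ be any fixed finite vector of ensemble evaluations $f_p(t)$ or fixed finite linear combinations of them. For the exact model and for a finite-rank approximation of it indexed by $\ell\in\mathbb N$, write the joint laws in $Y,G$ block order as $$\binom{Y}{G}\,\Big|\,\vartheta\sim N\left(\binom{\mu_Y}{\mu_G},\bigl[\Sigma_{AB}\bigr]_{A,B\in\{Y,G\}}\right),\qquad \binom{\widetilde Y^{(\ell)}}{\widetilde G^{(\ell)}}\,\Big|\,\vartheta\sim N\left(\binom{\widetilde\mu_Y^{(\ell)}}{\widetilde\mu_G^{(\ell)}},\bigl[\widetilde\Sigma^{(\ell)}_{AB}\bigr]_{A,B\in\{Y,G\}}\right),$$ where the $Y,Y$ blocks include the independent noise variance $\sigma^2I_n$. If, as $\ell\to\infty$, $\widetilde\mu_A^{(\ell)}\to\mu_A$ for $A\in\{Y,G\}$ and $\widetilde\Sigma_{AB}^{(\ell)}\to\Sigma_{AB}$ for all $A,B\in\{Y,G\}$, then for every fixed $y\in\mathbb R^n$ the conditional mean $\widetilde\mu^{(\ell)}_{G\mid Y}(y)$ and conditional covariance $\widetilde\Sigma^{(\ell)}_{G\mid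 Y}$ of $\widetilde G^{(\ell)}$ given $\widetilde Y^{(\ell)}=y$ satisfy $$\widetilde\mu^{(\ell)}_{G\mid Y}(y)\to\mu_G+\Sigma_{GY}\Sigma_{YY}^{-1}(y-\mu_Y),\qquad \widetilde\Sigma^{(\ell)}_{G\mid Y}\to\Sigma_{GG}-\Sigma_{GY}\Sigma_{YY}^{-1}\Sigma_{YG}.$$
   Context: Gaussian differential ensemble: $f_0\sim\mathcal{GP}(\mu,C_\theta)$ on $[t_0,t_1]$ with $\mu\in C^r$, $C_\theta\in C^{r,r}([t_0,t_1]^2)$ (continuous mixed partial derivatives up to order $r$ in each argument); $\boldsymbol\kappa=(\kappa_1,\dots,\kappa_r)^\top\sim N(\boldsymbol\mu_\kappa,\boldsymbol\Sigma_\kappa)$ is independent of $f_0$ ($\boldsymbol\Sigma_\kappa$ may be singular); $f_{-k}$ is the $k$th mean-square derivative of $f_0$, $k=1,\ldots,r$; and for $p=1,\ldots,r$, $f_p(t)=\frac1{(p-1)!}\int_{t_0}^t(t-u)^{p-1}f_0(u)\,du+\sum_{j=1}^p\frac{(t-t_0)^{p-j}}{(p-j)!}\kappa_j$. All evaluations of the ensemble are jointly Gaussian. A finite-rank approximation replaces the ensemble by another jointly Gaussian ensemble, with the same Gaussian observation noise of variance $\sigma^2$ independent of the ensemble; $\widetilde Y^{(\ell)},\widetilde G^{(\ell)}$ are the resulting counterparts of $Y,G$. It enters only through the displayed Gaussian joint law, whose $Y,Y$ block is the covariance of the approximate values of $f_0$ at $x_1,\dots,x_n$ plus $\sigma^2I_n$.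 *)

theory Defs
  imports "HOL-Probability.Probability"
begin

section \<open>Gaussian families\<close>

text \<open>A degenerate normal law (v = 0) is a point mass.\<close>

definition normal_rv :: "'a measure \<Rightarrow> ('a \<Rightarrow> real) \<Rightarrow> real \<Rightarrow> real \<Rightarrow> bool" where
  "normal_rv M X m v \<longleftrightarrow>
     X \<in> borel_measurable M \<and> 0 \<le> v \<and>
     distr M borel X =
       (if v = 0 then return borel m else density lborel (normal_density m (sqrt v)))"

text \<open>Every finite linear combination of the family is normal with the mean and variance
  prescribed by m and K. For finite T this is the multivariate normal law N(m, K), with K possibly
  singular; for infinite T it is a Gaussian process. Symmetry of K has to be required
  separately, because quadratic forms determine only the symmetric part of K.\<close>

definition gaussian_family ::
  "'a measure \<Rightarrow> 'i set \<Rightarrow> ('i \<Rightarrow> 'a \<Rightarrow> real) \<Rightarrow> ('i \<Rightarrow> real) \<Rightarrow> ('i \<Rightarrow> 'i \<Rightarrow> real) \<Rightarrow> bool" where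
  "gaussian_family M T X m K \<longleftrightarrow>
     (\<forall>i\<in>T. \<forall>j\<in>T. K i j = K j i) \<and>
     (\<forall>I a. finite I \<longrightarrow> I \<subseteq> T \<longrightarrow>
        normal_rv M (\<lambda>\<omega>. \<Sum>i\<in>I. a i * X i \<omega>)
          (\<Sum>i\<in>I. a i * m i) (\<Sum>i\<in>I. \<Sum>j\<in>I. a i * a j * K i j))"

definition jointly_gaussian :: "'a measure \<Rightarrow> 'i set \<Rightarrow> ('i \<Rightarrow> 'a \<Rightarrow> real) \<Rightarrow> bool" where
  "jointly_gaussian M T X \<longleftrightarrow> (\<exists>m K. gaussian_family M T X m K)"

text \<open>The block vector (Y, G) has the normal law with block mean (mY, mG) and block covariance
  matrix (SYY, SYG; SGY, SGG).\<close>

definition joint_normal_law ::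
  "'a measure \<Rightarrow> ('a \<Rightarrow> real^'n) \<Rightarrow> ('a \<Rightarrow> real^'d) \<Rightarrow> real^'n \<Rightarrow> real^'d \<Rightarrow>
   real^'n^'n \<Rightarrow> real^'d^'n \<Rightarrow> real^'n^'d \<Rightarrow> real^'d^'d \<Rightarrow> bool" where
  "joint_normal_law M Y G mY mG SYY SYG SGY SGG \<longleftrightarrow>
     gaussian_family M (UNIV :: ('n + 'd) set)
       (\<lambda>a \<omega>. case a of Inl i \<Rightarrow> Y \<omega> $ i | Inr k \<Rightarrow> G \<omega> $ k)
       (\<lambda>a. case a of Inl i \<Rightarrow> mY $ i | Inr k \<Rightarrow> mG $ k)
       (\<lambda>a b. case a of
          Inl i \<Rightarrow> (case b of Inl j \<Rightarrow> SYY $ i $ j | Inr l \<Rightarrow> SYG $ i $ l)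
        | Inr k \<Rightarrow> (case b of Inl j \<Rightarrow> SGY $ k $ j | Inr l \<Rightarrow> SGG $ k $ l))"

section \<open>Independence of families\<close>

text \<open>The sigma-algebra generated by the family (X i), i in T. Independence is stated through
  generated sigma-algebras since the library's indep_var needs both variables to have
  the same value type.\<close>

definition family_sigma :: "'a measure \<Rightarrow> 'i set \<Rightarrow> ('i \<Rightarrow> 'a \<Rightarrow> real) \<Rightarrow> 'a measure" where
  "family_sigma M T X =
     vimage_algebra (space M) (\<lambda>\<omega>. \<lambda>i\<in>T. X i \<omega>) (\<Pi>\<^sub>M i\<in>T. borel)"

definition indep_families ::
  "'a measure \<Rightarrow> 'i set \<Rightarrow> ('i \<Rightarrow> 'a \<Rightarrow> real) \<Rightarrow> 'j set \<Rightarrow> ('j \<Rightarrow> 'a \<Rightarrow> real) \<Rightarrow> bool" where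
  "indep_families M S X T Z \<longleftrightarrow>
     prob_space.indep_set M (sets (family_sigma M S X)) (sets (family_sigma M T Z))"

section \<open>Smoothness and mean-square derivatives\<close>

text \<open>D k is the k-th derivative of g on S (one-sided at endpoints of an interval).\<close>

definition Ck_on :: "nat \<Rightarrow> real set \<Rightarrow> (real \<Rightarrow> real) \<Rightarrow> bool" where
  "Ck_on r S g \<longleftrightarrow> (\<exists>D :: nat \<Rightarrow> real \<Rightarrow> real.
     (\<forall>t\<in>S. D 0 t = g t) \<and>
     (\<forall>k<r. \<forall>t\<in>S. (D k has_real_derivative D (Suc k) t) (at t within S)) \<and>
     (\<forall>k\<le>r. continuous_on S (D k)))"

text \<open>D i j is the mixed partial derivative of K of order i in the first and j in the
  second argument.\<close>

definition Ckk_on :: "nat \<Rightarrow> real set \<Rightarrow> (real \<Rightarrow> real \<Rightarrow> real) \<Rightarrow> bool" where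
  "Ckk_on r S K \<longleftrightarrow> (\<exists>D :: nat \<Rightarrow> nat \<Rightarrow> real \<Rightarrow> real \<Rightarrow> real.
     (\<forall>s\<in>S. \<forall>t\<in>S. D 0 0 s t = K s t) \<and>
     (\<forall>i<r. \<forall>j\<le>r. \<forall>s\<in>S. \<forall>t\<in>S.
        ((\<lambda>u. D i j u t) has_real_derivative D (Suc i) j s t) (at s within S)) \<and>
     (\<forall>i\<le>r. \<forall>j<r. \<forall>s\<in>S. \<forall>t\<in>S.
        ((\<lambda>u. D i j s u) has_real_derivative D i (Suc j) s t) (at t within S)) \<and>
     (\<forall>i\<le>r. \<forall>j\<le>r. continuous_on (S \<times> S) (\<lambda>(s, t). D i j s t)))"

text \<open>Stated with the nonnegative integral, so that difference quotients that are not square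
  integrable have infinite, not zero, distance from the derivative.\<close>

definition ms_derivative_on ::
  "'a measure \<Rightarrow> real set \<Rightarrow> (real \<Rightarrow> 'a \<Rightarrow> real) \<Rightarrow> (real \<Rightarrow> 'a \<Rightarrow> real) \<Rightarrow> bool" where
  "ms_derivative_on M S X X' \<longleftrightarrow>
     (\<forall>t\<in>S. X t \<in> borel_measurable M \<and> X' t \<in> borel_measurable M) \<and>
     (\<forall>t\<in>S. ((\<lambda>s. \<integral>\<^sup>+\<omega>. ennreal (((X s \<omega> - X t \<omega>) / (s - t) - X' t \<omega>)\<^sup>2) \<partial>M) \<longlongrightarrow> 0)
        (at t within S))"

section \<open>Gaussian differential ensembles\<close>

definition eval_points :: "nat \<Rightarrow> real \<Rightarrow> real \<Rightarrow> (int \<times> real) set" where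
  "eval_points r t0 t1 = {- int r..int r} \<times> {t0..t1}"

text \<open>f p t is the evaluation at t of the ensemble member of order p; the vector kappa is
  indexed by 1, ..., r. Joint measurability of f 0 makes the path integrals defining
  the members of positive order meaningful.\<close>

definition gaussian_differential_ensemble ::
  "'a measure \<Rightarrow> nat \<Rightarrow> real \<Rightarrow> real \<Rightarrow> (real \<Rightarrow> real) \<Rightarrow> (real \<Rightarrow> real \<Rightarrow> real) \<Rightarrow>
   (nat \<Rightarrow> real) \<Rightarrow> (nat \<Rightarrow> nat \<Rightarrow> real) \<Rightarrow> (nat \<Rightarrow> 'a \<Rightarrow> real) \<Rightarrow> (int \<Rightarrow> real \<Rightarrow> 'a \<Rightarrow> real) \<Rightarrow> bool"
where
  "gaussian_differential_ensemble M r t0 t1 \<mu> C \<mu>\<kappa> \<Sigma>\<kappa> \<kappa> f \<longleftrightarrow>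
     prob_space M \<and> t0 < t1 \<and>
     Ck_on r {t0..t1} \<mu> \<and> Ckk_on r {t0..t1} C \<and>
     gaussian_family M {t0..t1} (f 0) \<mu> C \<and>
     (\<lambda>(u, \<omega>). f 0 u \<omega>) \<in> borel_measurable (restrict_space borel {t0..t1} \<Otimes>\<^sub>M M) \<and>
     gaussian_family M {1..r} \<kappa> \<mu>\<kappa> \<Sigma>\<kappa> \<and>
     indep_families M {1..r} \<kappa> {t0..t1} (f 0) \<and>
     (\<forall>k<r. ms_derivative_on M {t0..t1} (f (- int k)) (f (- int (Suc k)))) \<and>
     (\<forall>p\<in>{1..r}. \<forall>t\<in>{t0..t1}. AE \<omega> in M.
        f (int p) t \<omega> =
          1 / fact (p - 1) * (LINT u:{t0..t}|lborel. (t - u) ^ (p - 1) * f 0 u \<omega>) +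
          (\<Sum>j=1..p. (t - t0) ^ (p - j) / fact (p - j) * \<kappa> j \<omega>)) \<and>
     jointly_gaussian M (eval_points r t0 t1) (case_prod f)"

text \<open>Independent N(0, v) errors that are jointly independent of the family (X q), q in T.\<close>

definition gaussian_noise ::
  "'a measure \<Rightarrow> ('n::finite \<Rightarrow> 'a \<Rightarrow> real) \<Rightarrow> real \<Rightarrow> 'q set \<Rightarrow> ('q \<Rightarrow> 'a \<Rightarrow> real) \<Rightarrow> bool" where
  "gaussian_noise M \<epsilon> v T X \<longleftrightarrow>
     (\<forall>i. normal_rv M (\<epsilon> i) 0 v) \<and>
     prob_space.indep_vars M (\<lambda>_. borel) \<epsilon> UNIV \<and>
     indep_families M UNIV \<epsilon> T X"

definition noisy_obs ::
  "(int \<Rightarrow> real \<Rightarrow> 'a \<Rightarrow> real) \<Rightarrow> ('n::finite \<Rightarrow> 'a \<Rightarrow> real) \<Rightarrow> ('n \<Rightarrow> real) \<Rightarrow> 'a \<Rightarrow> real^'n" where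
  "noisy_obs f \<epsilon> x \<omega> = (\<chi> i. f 0 (x i) \<omega> + \<epsilon> i \<omega>)"

text \<open>Component k is the linear combination, with coefficients c k, of the evaluations at the
  pairs (p, t) in J k; a single evaluation is the case of a singleton with coefficient 1.\<close>

definition lin_evals ::
  "(int \<Rightarrow> real \<Rightarrow> 'a \<Rightarrow> real) \<Rightarrow> ('d::finite \<Rightarrow> (int \<times> real) set) \<Rightarrow> ('d \<Rightarrow> int \<times> real \<Rightarrow> real) \<Rightarrow>
   'a \<Rightarrow> real^'d" where
  "lin_evals f J c \<omega> = (\<chi> k. \<Sum>(p, t)\<in>J k. c k (p, t) * f p t \<omega>)"

section \<open>Conditional mean and covariance at a point\<close>

text \<open>The conditional mean of G given Y = y as a function of y: the continuous function m such that
  m(Y) is a version of E[G | Y]. If Y has a law with full support (as for observations with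
  nondegenerate Gaussian noise), there is at most one continuous version, so that the value at
  every single point y is determined. The conditional covariance is defined in the same way from
  E[(G - m(Y)) (G - m(Y))^T | Y].\<close>

abbreviation cond_exp_given ::
  "'a measure \<Rightarrow> ('a \<Rightarrow> real^'n) \<Rightarrow> ('a \<Rightarrow> real) \<Rightarrow> 'a \<Rightarrow> real" where
  "cond_exp_given M Y Z \<equiv> real_cond_exp M (vimage_algebra (space M) Y borel) Z"

definition cond_mean ::
  "'a measure \<Rightarrow> ('a \<Rightarrow> real^'n) \<Rightarrow> ('a \<Rightarrow> real^'d) \<Rightarrow> real^'n \<Rightarrow> real^'d" where
  "cond_mean M Y G = (THE m. continuous_on UNIV m \<and>
     (\<forall>k. AE \<omega> in M. cond_exp_given M Y (\<lambda>\<omega>. G \<omega> $ k) \<omega> = m (Y \<omega>) $ k))"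

definition cond_cov ::
  "'a measure \<Rightarrow> ('a \<Rightarrow> real^'n) \<Rightarrow> ('a \<Rightarrow> real^'d) \<Rightarrow> real^'n \<Rightarrow> real^'d^'d" where
  "cond_cov M Y G = (THE S. continuous_on UNIV S \<and>
     (\<forall>k l. AE \<omega> in M.
        cond_exp_given M Y
          (\<lambda>\<omega>. (G \<omega> $ k - cond_mean M Y G (Y \<omega>) $ k) * (G \<omega> $ l - cond_mean M Y G (Y \<omega>) $ l)) \<omega>
        = S (Y \<omega>) $ k $ l))"

end

theory Submission
  imports Defs
begin

text \<open>The residual \<open>G - \<mu>G - \<Sigma>GY \<Sigma>YY\<^sup>-\<^sup>1 (Y - \<mu>Y)\<close> is uncorrelated with \<open>Y\<close>, hence independent of
  it, which gives the usual Gaussian conditioning formulas. Because of the independent noise, the law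
  of \<open>Y\<close> has full support (so continuous versions of conditional moments are unique), and
  \<open>\<Sigma>YY \<ge> \<sigma>\<^sup>2 I\<close> uniformly over all models. The uniform bound passes to the limit and makes the
  inverses converge.\<close>

section \<open>Weighted characteristic functions\<close>

text \<open>\<open>cond_mean\<close> and \<open>cond_cov\<close> are definite descriptions over all
  continuous versions, so evaluating them at a single \<open>y\<close> takes existence and
  uniqueness, not just an almost sure formula. Each model lives on its own space \<open>N l\<close>
  and is linked to the others only by its parameters; hence every model is conditioned separately
  and the limit is taken in the closed formulas. \<open>gaussian_family\<close> speaks only of
  one-dimensional laws of linear combinations, so joint information is extracted from characteristic
  functions. Levy uniqueness on the line is extended to vectors one coordinate at a time, and
  independence is obtained for one linear combination \<open>X\<close> against the vector
  \<open>Y\<close>. Products of two residuals are reached from there by polarization.\<close>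

lemma (in prob_space) real_weighted_char_zero:
  fixes V X :: "'a \<Rightarrow> real" and h :: "real \<Rightarrow> real"
  assumes V: "integrable M V" and X[measurable]: "X \<in> borel_measurable M"
    and zero: "\<And>s. (\<integral>\<omega>. of_real (V \<omega>) * iexp (s * X \<omega>) \<partial>M) = 0"
    and h[measurable]: "h \<in> borel_measurable borel"
    and Vh: "integrable M (\<lambda>\<omega>. V \<omega> * h (X \<omega>))"
  shows "(\<integral>\<omega>. V \<omega> * h (X \<omega>) \<partial>M) = 0"
proof -
  \<comment> \<open>Splitting the weight into its two parts turns the signed measure with density
    \<open>V\<close> into a difference of finite measures, to which uniqueness of characteristic
    functions can be applied.\<close>
  define p where "p \<omega> = max 0 (V \<omega>)" for \<omega>
  define n where "n \<omega> = max 0 (- V \<omega>)" for \<omega>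
  have [measurable]: "V \<in> borel_measurable M" using V by auto
  have [measurable]: "p \<in> borel_measurable M" "n \<in> borel_measurable M"
    unfolding p_def[abs_def] n_def[abs_def] by measurable
  have Vpn: "V \<omega> = p \<omega> - n \<omega>" for \<omega> by (auto simp: p_def n_def)
  have pos: "p \<omega> \<ge> 0" "n \<omega> \<ge> 0" for \<omega> by (auto simp: p_def n_def)
  have int: "integrable M p" "integrable M n"
    by (auto intro!: Bochner_Integration.integrable_bound[OF V] simp: p_def n_def)
  have bounded: "integrable M (\<lambda>\<omega>. of_real (q \<omega>) * iexp (s * X \<omega>))"
    if [measurable]: "integrable M q" for q s
    by (rule Bochner_Integration.integrable_bound[OF that]) (auto simp: norm_mult)
  define c where "c = (\<integral>\<omega>. p \<omega> \<partial>M)"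
  have char_eq: "(\<integral>\<omega>. of_real (p \<omega>) * iexp (s * X \<omega>) \<partial>M)
      = (\<integral>\<omega>. of_real (n \<omega>) * iexp (s * X \<omega>) \<partial>M)" for s
    using zero[of s] bounded[OF int(1), of s] bounded[OF int(2), of s]
    by (simp add: Vpn left_diff_distrib)
  \<comment> \<open>At \<open>s = 0\<close> the hypothesis says that both parts have the same total
    mass \<open>c\<close>, so one normalization serves for both.\<close>
  have "complex_of_real (\<integral>\<omega>. p \<omega> \<partial>M) = complex_of_real (\<integral>\<omega>. n \<omega> \<partial>M)"
    using char_eq[of 0] by simp
  then have cn: "(\<integral>\<omega>. n \<omega> \<partial>M) = c" by (simp add: c_def)
  have c0: "c \<ge> 0" unfolding c_def using pos by simp
  show ?thesis
  proof (cases "c = 0")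
    case True
    then have "AE \<omega> in M. p \<omega> = 0" "AE \<omega> in M. n \<omega> = 0"
      using cn int pos integral_nonneg_eq_0_iff_AE[of M p] integral_nonneg_eq_0_iff_AE[of M n]
      by (simp_all add: c_def)
    then have "AE \<omega> in M. V \<omega> * h (X \<omega>) = 0" by eventually_elim (simp add: Vpn)
    then show ?thesis by (simp add: integral_eq_zero_AE)
  next
    case False
    with c0 have c: "c > 0" by simp
    \<comment> \<open>The law of \<open>X\<close> under the probability measure with density
      \<open>q / c\<close>. The laws for \<open>q = p\<close> and \<open>q = n\<close> have equal
      characteristic functions and therefore coincide.\<close>
    define D where "D q = distr (density M (\<lambda>\<omega>. ennreal (q \<omega> / c))) borel X" for q
    have D_int: "integral\<^sup>L (D q) g = (\<integral>\<omega>. (q \<omega> / c) *\<^sub>R g (X \<omega>) \<partial>M)"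
      if [measurable]: "q \<in> borel_measurable M" "g \<in> borel_measurable borel" and "\<And>\<omega>. q \<omega> \<ge> 0"
      for q and g :: "real \<Rightarrow> 'z::{banach, second_countable_topology}"
      unfolding D_def using c that by (simp add: integral_distr integral_density)
    have D_dist: "real_distribution (D q)"
      if [measurable]: "integrable M q" and q: "\<And>\<omega>. q \<omega> \<ge> 0" "(\<integral>\<omega>. q \<omega> \<partial>M) = c" for q
    proof -
      have "(\<integral>\<^sup>+\<omega>. ennreal (q \<omega> / c) \<partial>M) = ennreal (\<integral>\<omega>. q \<omega> / c \<partial>M)"
        by (rule nn_integral_eq_integral) (use that c in auto)
      also have "\<dots> = 1" using that c by simp
      finally have "prob_space (density M (\<lambda>\<omega>. ennreal (q \<omega> / c)))"
        by (intro prob_spaceI) (simp add: emeasure_density cong: nn_integral_cong)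
      then interpret D: prob_space "density M (\<lambda>\<omega>. ennreal (q \<omega> / c))" .
      show ?thesis unfolding D_def
        by (intro D.real_distribution_distr) simp
    qed
    have char_D: "char (D q) s = (\<integral>\<omega>. of_real (q \<omega>) * iexp (s * X \<omega>) \<partial>M) / c"
      if [measurable]: "q \<in> borel_measurable M" and "\<And>\<omega>. q \<omega> \<ge> 0" for q s
      unfolding char_def by (subst D_int) (use that in \<open>auto simp: scaleR_conv_of_real\<close>)
    have "char (D p) = char (D n)"
      by (rule ext) (simp add: char_D pos char_eq del: of_real_mult)
    then have "D p = D n"
      by (intro Levy_uniqueness D_dist int pos cn) (simp_all add: c_def)
    then have eq: "(\<integral>\<omega>. p \<omega> / c * h (X \<omega>) \<partial>M) = (\<integral>\<omega>. n \<omega> / c * h (X \<omega>) \<partial>M)"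
      using D_int[of p h] D_int[of n h] pos by auto
    \<comment> \<open>\<open>h\<close> may be unbounded; both parts are dominated by
      \<open>V\<close>, so integrability comes from \<open>Vh\<close>.\<close>
    have "integrable M (\<lambda>\<omega>. p \<omega> * h (X \<omega>))" "integrable M (\<lambda>\<omega>. n \<omega> * h (X \<omega>))"
      by (auto intro!: Bochner_Integration.integrable_bound[OF Vh] always_eventually mult_right_mono
          simp: p_def n_def abs_mult)
    then show ?thesis using eq c by (simp add: Vpn left_diff_distrib)
  qed
qed

text \<open>Conjugating the weight only replaces \<open>s\<close> by \<open>- s\<close>, so real and
  imaginary parts inherit the hypothesis. Complex weights matter because the vector version absorbs
  the exponentials of the remaining coordinates into the weight.\<close>

lemma (in prob_space) weighted_char_zero:
  fixes V :: "'a \<Rightarrow> complex" and X :: "'a \<Rightarrow> real"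
  assumes V: "integrable M V" and X[measurable]: "X \<in> borel_measurable M"
    and zero: "\<And>s. (\<integral>\<omega>. V \<omega> * iexp (s * X \<omega>) \<partial>M) = 0"
    and B[measurable]: "B \<in> sets borel"
  shows "(\<integral>\<omega>. V \<omega> * indicator B (X \<omega>) \<partial>M) = 0"
proof -
  have [measurable]: "V \<in> borel_measurable M" using V by auto
  have bounded: "integrable M (\<lambda>\<omega>. q \<omega> * iexp (s * X \<omega>))"
    if [measurable]: "integrable M q" for q s
    by (rule Bochner_Integration.integrable_bound[OF that]) (auto simp: norm_mult)
  have cnj: "(\<integral>\<omega>. cnj (V \<omega>) * iexp (s * X \<omega>) \<partial>M) = 0" for s
  proof -
    have "(\<integral>\<omega>. cnj (V \<omega>) * iexp (s * X \<omega>) \<partial>M) = cnj (\<integral>\<omega>. V \<omega> * iexp (- s * X \<omega>) \<partial>M)"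
      by (subst Bochner_Integration.integral_cnj[symmetric]) (simp add: exp_cnj)
    then show ?thesis using zero[of "- s"] by simp
  qed
  have re: "(\<integral>\<omega>. of_real (Re (V \<omega>)) * iexp (s * X \<omega>) \<partial>M) = 0" for s
  proof -
    have *: "of_real (Re (V \<omega>)) * iexp (s * X \<omega>)
        = (V \<omega> * iexp (s * X \<omega>) + cnj (V \<omega>) * iexp (s * X \<omega>)) / 2" for \<omega>
      by (simp add: complex_add_cnj flip: distrib_right)
    show ?thesis unfolding *
      using zero[of s] cnj[of s] bounded[OF V, of s] bounded[OF integrable_cnj[OF V], of s] by simp
  qed
  have im: "(\<integral>\<omega>. of_real (Im (V \<omega>)) * iexp (s * X \<omega>) \<partial>M) = 0" for s
  proof -
    have *: "of_real (Im (V \<omega>)) * iexp (s * X \<omega>)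
        = (V \<omega> * iexp (s * X \<omega>) - cnj (V \<omega>) * iexp (s * X \<omega>)) / (2 * \<i>)" for \<omega>
      by (simp add: complex_diff_cnj mult.left_commute flip: left_diff_distrib)
    show ?thesis unfolding *
      using zero[of s] cnj[of s] bounded[OF V, of s] bounded[OF integrable_cnj[OF V], of s] by simp
  qed
  have ind: "integrable M (\<lambda>\<omega>. q \<omega> * indicator B (X \<omega>))"
    if [measurable]: "integrable M q" for q :: "'a \<Rightarrow> 'z::{real_normed_field, banach, second_countable_topology}"
    by (rule Bochner_Integration.integrable_bound[OF that]) (auto simp: indicator_def)
  have "(\<integral>\<omega>. Re (V \<omega>) * indicator B (X \<omega>) \<partial>M) = 0" "(\<integral>\<omega>. Im (V \<omega>) * indicator B (X \<omega>) \<partial>M) = 0"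
    using real_weighted_char_zero[OF _ X re, of "indicator B"]
      real_weighted_char_zero[OF _ X im, of "indicator B"] V
    by (simp_all add: ind)
  moreover have "Re (V \<omega> * indicator B (X \<omega>)) = Re (V \<omega>) * indicator B (X \<omega>)"
     "Im (V \<omega> * indicator B (X \<omega>)) = Im (V \<omega>) * indicator B (X \<omega>)" for \<omega>
    by (auto simp: indicator_def)
  ultimately show ?thesis
    using ind[OF V] by (intro complex_eqI) (simp_all flip: integral_Re integral_Im)
qed

text \<open>Exponentials are exchanged for half-line indicators one coordinate at a time, each time
  by the one-dimensional result. This settles lower orthants, an intersection-stable generator of
  the Borel sets, and a Dynkin argument does the rest.\<close>

lemma (in prob_space) weighted_char_zero_vec:
  fixes V :: "'a \<Rightarrow> complex" and Y :: "'a \<Rightarrow> real^'n"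
  assumes V: "integrable M V" and Y[measurable]: "Y \<in> borel_measurable M"
    and zero: "\<And>t. (\<integral>\<omega>. V \<omega> * iexp (t \<bullet> Y \<omega>) \<partial>M) = 0"
    and A: "A \<in> sets borel"
  shows "(\<integral>\<omega>. V \<omega> * indicator A (Y \<omega>) \<partial>M) = 0"
proof -
  have [measurable]: "V \<in> borel_measurable M" using V by auto
  have coord[measurable]: "(\<lambda>\<omega>. Y \<omega> $ i) \<in> borel_measurable M" for i
    by (simp add: cart_eq_inner_axis)
  have ind: "integrable M (\<lambda>\<omega>. V \<omega> * indicator A (Y \<omega>))" if [measurable]: "A \<in> sets borel" for A
    by (rule Bochner_Integration.integrable_bound[OF V]) (auto simp: indicator_def)
  \<comment> \<open>Coordinates in \<open>I\<close> already carry indicators, the others still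
    exponentials: \<open>I = {}\<close> is the hypothesis, \<open>I = UNIV\<close> the case of an
    orthant.\<close>
  have partial: "(\<integral>\<omega>. V \<omega> * (\<Prod>i\<in>I. indicator {..b i} (Y \<omega> $ i))
      * iexp (\<Sum>i\<in>-I. t i * Y \<omega> $ i) \<partial>M) = 0" for b t and I :: "'n set"
  proof (induction I arbitrary: t rule: finite_induct[OF finite])
    case 1
    show ?case using zero[of "\<chi> i. t i"] by (simp add: inner_vec_def)
  next
    case (2 j I)
    let ?W = "\<lambda>\<omega>. V \<omega> * (\<Prod>i\<in>I. indicator {..b i} (Y \<omega> $ i))
      * iexp (\<Sum>i\<in>-(insert j I). t i * Y \<omega> $ i)"
    have "integrable M ?W"
      by (rule Bochner_Integration.integrable_bound[OF V])
        (auto simp: norm_mult prod_norm[symmetric] indicator_def intro!: mult_left_le prod_le_1)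
    \<comment> \<open>The induction hypothesis holds for all frequency vectors; overwriting the
      entry \<open>j\<close> of \<open>t\<close> by \<open>s\<close> yields the full characteristic
      function in the coordinate \<open>j\<close>.\<close>
    moreover have "(\<integral>\<omega>. ?W \<omega> * iexp (s * Y \<omega> $ j) \<partial>M) = 0" for s
    proof -
      have *: "- I = insert j (- insert j I)" using 2 by auto
      have "(\<Sum>i\<in>-I. (t(j := s)) i * Y \<omega> $ i)
          = s * Y \<omega> $ j + (\<Sum>i\<in>-(insert j I). t i * Y \<omega> $ i)" for \<omega>
        by (subst *, subst sum.insert) (auto intro!: sum.cong)
      then show ?thesis
        using "2.IH"[of "t(j := s)"]
        by (simp add: distrib_left exp_add mult_ac)
    qed
    ultimately have "(\<integral>\<omega>. ?W \<omega> * indicator {..b j} (Y \<omega> $ j) \<partial>M) = 0"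
      by (intro weighted_char_zero) auto
    then show ?case using 2 by (simp add: mult_ac)
  qed
  \<comment> \<open>The case of the whole space, which the complement step subtracts from.\<close>
  have total: "(\<integral>\<omega>. V \<omega> \<partial>M) = 0" using zero[of 0] by simp
  have "Int_stable (range (\<lambda>a::real^'n. {..a}))"
  proof (rule Int_stableI_image)
    fix a b :: "real^'n"
    have "{..a} \<inter> {..b} = {..(\<chi> i. min (a $ i) (b $ i))}" by (auto simp: less_eq_vec_def)
    then show "\<exists>c\<in>UNIV. {..a} \<inter> {..b} = {..c}" by blast
  qed
  moreover have "range (\<lambda>a::real^'n. {..a}) \<subseteq> Pow UNIV" by simp
  moreover have "A \<in> sigma_sets UNIV (range (\<lambda>a::real^'n. {..a}))"
    using A by (simp add: borel_eq_atMost)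
  ultimately show ?thesis
  proof (induction rule: sigma_sets_induct_disjoint)
    case (basic A)
    then obtain a where [simp]: "A = {..a}" by auto
    have "indicator {..a} (Y \<omega>) = (\<Prod>i\<in>UNIV. indicator {..a $ i} (Y \<omega> $ i) :: complex)" for \<omega>
      by (auto simp: indicator_def less_eq_vec_def)
    then show ?case using partial[of "\<lambda>i. a $ i" UNIV] by simp
  next
    case (compl A)
    then have [measurable]: "A \<in> sets borel" by (simp add: borel_eq_atMost)
    have "V \<omega> * indicator (UNIV - A) (Y \<omega>) = V \<omega> - V \<omega> * indicator A (Y \<omega>)" for \<omega>
      by (auto simp: indicator_def)
    then show ?case using compl total ind[of A] V by simp
  next
    case (union A)
    then have [measurable]: "A i \<in> sets borel" for i by (auto simp: borel_eq_atMost)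
    have eq: "(LINT \<omega>:(Y -` B \<inter> space M)|M. V \<omega>) = (\<integral>\<omega>. V \<omega> * indicator B (Y \<omega>) \<partial>M)" for B
      unfolding set_lebesgue_integral_def
      by (intro Bochner_Integration.integral_cong) (auto simp: indicator_def)
    have un: "(\<Union>i. Y -` A i \<inter> space M) = Y -` (\<Union>i. A i) \<inter> space M" by auto
    have "(LINT \<omega>:(\<Union>i. Y -` A i \<inter> space M)|M. V \<omega>) = (\<Sum>i. LINT \<omega>:(Y -` A i \<inter> space M)|M. V \<omega>)"
    proof (rule lebesgue_integral_countable_add)
      show "Y -` A i \<inter> space M \<inter> (Y -` A j \<inter> space M) = {}" if "i \<noteq> j" for i j
        using union(1) that by (auto simp: disjoint_family_on_def)
      show "set_integrable M (\<Union>i. Y -` A i \<inter> space M) V"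
        unfolding set_integrable_def by (intro integrable_mult_indicator V) measurable
    qed measurable
    then show ?case using union(3) unfolding un eq by simp
  qed simp
qed

section \<open>Gaussian families\<close>

lemma normal_rvD:
  assumes "normal_rv M X m v"
  shows "X \<in> borel_measurable M" "0 \<le> v"
  using assms by (auto simp: normal_rv_def)

lemma normal_rv_degenerate:
  assumes "normal_rv M X m 0"
  shows "AE \<omega> in M. X \<omega> = m"
proof (rule AE_distrD[of X M borel "\<lambda>x. x = m"])
  show "X \<in> borel_measurable M" using normal_rvD[OF assms] by simp
  have "distr M borel X = return borel m" using assms by (simp add: normal_rv_def)
  then show "AE x in distr M borel X. x = m" by (simp only:) (subst AE_return; simp)
qed

lemma normal_rv_distributed:
  assumes "normal_rv M X m v" "v > 0"
  shows "distributed M lborel X (normal_density m (sqrt v))"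
  using assms unfolding distributed_def normal_rv_def
  by (auto cong: distr_cong)

text \<open>A point mass is evaluated directly; for \<open>v > 0\<close> the density gives the
  moments, and standardizing reduces the characteristic function to the standard normal one. The
  formulas are uniform in \<open>v\<close>, so singular covariances need no special treatment
  later.\<close>

lemma (in prob_space) normal_rv_moments:
  assumes X: "normal_rv M X m v"
  shows "integrable M X" "integrable M (\<lambda>\<omega>. (X \<omega> - m)\<^sup>2)"
    "expectation X = m" "expectation (\<lambda>\<omega>. (X \<omega> - m)\<^sup>2) = v"
    "\<And>t. expectation (\<lambda>\<omega>. iexp (t * X \<omega>)) = iexp (t * m) * exp (- (t\<^sup>2 * v) / 2)"
proof -
  note [measurable] = normal_rvD(1)[OF X]
  have "integrable M X \<and> integrable M (\<lambda>\<omega>. (X \<omega> - m)\<^sup>2) \<and>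
    expectation X = m \<and> expectation (\<lambda>\<omega>. (X \<omega> - m)\<^sup>2) = v \<and>
    (\<forall>t. expectation (\<lambda>\<omega>. iexp (t * X \<omega>)) = iexp (t * m) * exp (- (t\<^sup>2 * v) / 2))"
  proof (cases "v = 0")
    case True
    with X have ae: "AE \<omega> in M. X \<omega> = m" using normal_rv_degenerate by blast
    have ig: "integrable M (\<lambda>\<omega>. g (X \<omega>)) \<and> expectation (\<lambda>\<omega>. g (X \<omega>)) = g m"
      if [measurable]: "g \<in> borel_measurable borel"
      for g :: "real \<Rightarrow> 'z::{banach, second_countable_topology}"
    proof -
      have "integrable M (\<lambda>\<omega>. g (X \<omega>)) \<longleftrightarrow> integrable M (\<lambda>\<omega>. g m)"
        using ae by (intro integrable_cong_AE) auto
      moreover have "expectation (\<lambda>\<omega>. g (X \<omega>)) = expectation (\<lambda>\<omega>. g m)"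
        using ae by (intro integral_cong_AE) auto
      ultimately show ?thesis by (simp add: prob_space)
    qed
    have "expectation (\<lambda>\<omega>. iexp (t * X \<omega>)) = iexp (t * m)" for t
      using ig[of "\<lambda>x. iexp (t * x)"] by simp
    then show ?thesis
      using ig[of "\<lambda>x. x"] ig[of "\<lambda>x. (x - m)\<^sup>2"] True by simp
  next
    case False
    with normal_rvD(2)[OF X] have v: "v > 0" by simp
    note D = normal_rv_distributed[OF X v]
    have s: "sqrt v > 0" using v by simp
    have 1: "integrable M X"
      using distributed_integrable[OF D, of "\<lambda>x. x"] integrable_normal_moment_nz_1[OF s] by simp
    have 2: "integrable M (\<lambda>\<omega>. (X \<omega> - m)\<^sup>2)"
      using distributed_integrable[OF D, of "\<lambda>x. (x - m)\<^sup>2"] integrable_normal_moment[OF s, of m 2] by simp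
    have 3: "expectation X = m" by (rule normal_distributed_expectation[OF s D])
    have 4: "expectation (\<lambda>\<omega>. (X \<omega> - m)\<^sup>2) = v"
      using normal_distributed_variance[OF s D] v 3 by simp
    define Z where "Z \<omega> = (X \<omega> - m) / sqrt v" for \<omega>
    have [measurable]: "Z \<in> borel_measurable M" unfolding Z_def[abs_def] by simp
    have "distributed M lborel Z std_normal_density"
      using D normal_standard_normal_convert[OF s] by (simp add: Z_def[abs_def])
    then have "distr M borel Z = std_normal_distribution"
      by (simp add: distributed_def cong: distr_cong)
    then have "expectation (\<lambda>\<omega>. iexp (t * sqrt v * Z \<omega>)) = exp (- (t\<^sup>2 * v) / 2)" for t
      using char_std_normal_distribution[THEN fun_cong, of "t * sqrt v"] v
      by (simp add: char_def integral_distr power_mult_distrib flip: \<open>distr M borel Z = _\<close>)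
    moreover have "iexp (t * X \<omega>) = iexp (t * m) * iexp (t * sqrt v * Z \<omega>)" for t \<omega>
    proof -
      have "X \<omega> = m + sqrt v * Z \<omega>" using s by (simp add: Z_def)
      then show ?thesis by (simp add: distrib_left exp_add mult_ac)
    qed
    ultimately show ?thesis using 1 2 3 4 by simp
  qed
  then show "integrable M X" "integrable M (\<lambda>\<omega>. (X \<omega> - m)\<^sup>2)"
    "expectation X = m" "expectation (\<lambda>\<omega>. (X \<omega> - m)\<^sup>2) = v"
    "\<And>t. expectation (\<lambda>\<omega>. iexp (t * X \<omega>)) = iexp (t * m) * exp (- (t\<^sup>2 * v) / 2)" by auto
qed

lemma gaussian_family_sum:
  fixes Z :: "'i::finite \<Rightarrow> 'a \<Rightarrow> real"
  assumes "gaussian_family M UNIV Z m K"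
  shows "normal_rv M (\<lambda>\<omega>. \<Sum>i\<in>UNIV. a i * Z i \<omega>) (\<Sum>i\<in>UNIV. a i * m i)
    (\<Sum>i\<in>UNIV. \<Sum>j\<in>UNIV. a i * a j * K i j)"
  using assms unfolding gaussian_family_def by auto

lemma gaussian_family_single:
  assumes "gaussian_family M T Z m K" "i \<in> T"
  shows "normal_rv M (Z i) (m i) (K i i)"
  using assms(1)[unfolded gaussian_family_def, THEN conjunct2, rule_format, of "{i}" "\<lambda>_. 1"] assms(2)
  by simp

text \<open>Uncorrelated jointly Gaussian variables are independent: \<open>iexp (u * X)\<close> minus its mean is
  orthogonal to every \<open>iexp (t \<bullet> Y)\<close>, hence to every event of \<open>Y\<close>; therefore the centred indicator of
  such an event is orthogonal to every \<open>iexp (u * X)\<close>, hence to every function of \<open>X\<close>.\<close>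

lemma (in prob_space) gaussian_family_uncorrelated_indep:
  fixes Z :: "'i::finite \<Rightarrow> 'a \<Rightarrow> real" and Y :: "'a \<Rightarrow> real^'n" and g :: "'n \<Rightarrow> 'i" and a :: "'i \<Rightarrow> real"
  defines "X \<equiv> \<lambda>\<omega>. \<Sum>i\<in>UNIV. a i * Z i \<omega>"
  assumes gf: "gaussian_family M UNIV Z m K"
    and Y[measurable]: "Y \<in> borel_measurable M" and YZ: "\<And>\<omega> j. Y \<omega> $ j = Z (g j) \<omega>"
    and orth: "\<And>j. (\<Sum>i\<in>UNIV. a i * K i (g j)) = 0"
    and A[measurable]: "A \<in> sets borel"
    and h[measurable]: "h \<in> borel_measurable borel" and hX: "integrable M (\<lambda>\<omega>. h (X \<omega>))"
  shows "(\<integral>\<omega>. indicator A (Y \<omega>) * h (X \<omega>) \<partial>M) = prob (Y -` A \<inter> space M) * expectation (\<lambda>\<omega>. h (X \<omega>))"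
proof -
  define Q where "Q a b = (\<Sum>i\<in>UNIV. \<Sum>j\<in>UNIV. a i * b j * K i j)" for a b
  have sym: "K i j = K j i" for i j using gf by (simp add: gaussian_family_def)
  have Qcomm: "Q a b = Q b a" for a b
    unfolding Q_def by (subst sum.swap) (simp add: sym mult_ac)
  have Qadd: "Q (\<lambda>i. a i + b i) c = Q a c + Q b c" for a b c
    by (simp add: Q_def algebra_simps sum.distrib)
  have Qscale: "Q (\<lambda>i. u * a i) b = u * Q a b" for u a b
    by (simp add: Q_def sum_distrib_left mult_ac)
  have X[measurable]: "X \<in> borel_measurable M"
    unfolding X_def using normal_rvD(1)[OF gaussian_family_sum[OF gf]] .
  have char: "expectation (\<lambda>\<omega>. iexp (\<Sum>i\<in>UNIV. c i * Z i \<omega>)) = iexp (\<Sum>i\<in>UNIV. c i * m i) * exp (- Q c c / 2)" for c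
    using normal_rv_moments(5)[OF gaussian_family_sum[OF gf, of c], of 1] unfolding Q_def by simp
  have factor: "expectation (\<lambda>\<omega>. iexp (u * X \<omega>) * iexp (t \<bullet> Y \<omega>))
      = expectation (\<lambda>\<omega>. iexp (u * X \<omega>)) * expectation (\<lambda>\<omega>. iexp (t \<bullet> Y \<omega>))" for u t
  proof -
    \<comment> \<open>Coefficients of \<open>t \<bullet> Y\<close> in the family \<open>Z\<close>.
      The sum collects all \<open>j\<close> with the same image, because \<open>g\<close> may repeat
      indices.\<close>
    define b where "b i = (\<Sum>j\<in>UNIV. if g j = i then t $ j else 0)" for i
    have b_sum: "(\<Sum>i\<in>UNIV. b i * q i) = (\<Sum>j\<in>UNIV. t $ j * q (g j))" for q :: "'i \<Rightarrow> real"
      unfolding b_def sum_distrib_right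
      by (subst sum.swap) (simp add: if_distrib[of "\<lambda>x. x * _"] cong: if_cong)
    have tY: "t \<bullet> Y \<omega> = (\<Sum>i\<in>UNIV. b i * Z i \<omega>)" for \<omega>
      by (simp add: b_sum inner_vec_def YZ)
    have uX: "u * X \<omega> = (\<Sum>i\<in>UNIV. (u * a i) * Z i \<omega>)" for \<omega>
      by (simp add: X_def sum_distrib_left mult_ac)
    have uXtY: "u * X \<omega> + t \<bullet> Y \<omega> = (\<Sum>i\<in>UNIV. (u * a i + b i) * Z i \<omega>)" for \<omega>
      by (simp add: uX tY distrib_right sum.distrib)
    have "Q b a = (\<Sum>i\<in>UNIV. b i * (\<Sum>j\<in>UNIV. a j * K j i))"
      by (simp add: Q_def sum_distrib_left mult_ac sym)
    then have Qba: "Q b a = 0" by (simp add: b_sum orth)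
    \<comment> \<open>The cross term is \<open>2 * u * Q b a\<close>, which vanishes by
      orthogonality; additivity of the exponent is what makes the characteristic function
      factor.\<close>
    have "Q (\<lambda>i. u * a i + b i) (\<lambda>i. u * a i + b i)
        = Q (\<lambda>i. u * a i) (\<lambda>i. u * a i) + Q b b"
      using Qba by (simp add: Qadd Qscale Qcomm[of _ "\<lambda>i. u * a i + b i"] Qcomm[of _ "\<lambda>i. u * a i"] Qcomm[of a b])
    then have Q_sum: "- Q (\<lambda>i. u * a i + b i) (\<lambda>i. u * a i + b i) / 2
        = - Q (\<lambda>i. u * a i) (\<lambda>i. u * a i) / 2 + - Q b b / 2"
      by (simp add: add_divide_distrib)
    have m_sum: "(\<Sum>i\<in>UNIV. (u * a i + b i) * m i) = (\<Sum>i\<in>UNIV. u * a i * m i) + (\<Sum>i\<in>UNIV. b i * m i)"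
      by (simp add: distrib_right sum.distrib)
    have "expectation (\<lambda>\<omega>. iexp (u * X \<omega> + t \<bullet> Y \<omega>))
      = expectation (\<lambda>\<omega>. iexp (u * X \<omega>)) * expectation (\<lambda>\<omega>. iexp (t \<bullet> Y \<omega>))"
      unfolding uXtY unfolding uX tY char Q_sum m_sum
      by (simp only: of_real_add distrib_left exp_add of_real_mult mult_ac)
    then show ?thesis by (simp add: distrib_left exp_add)
  qed
  have bounded: "integrable M f" if "f \<in> borel_measurable M" "\<And>\<omega>. norm (f \<omega>) \<le> 1" for f :: "'a \<Rightarrow> complex"
    using that by (intro integrable_const_bound[of _ 1]) auto
  have indP: "expectation (\<lambda>\<omega>. indicator A (Y \<omega>) :: complex) = prob (Y -` A \<inter> space M)"
  proof -
    have "expectation (\<lambda>\<omega>. indicator A (Y \<omega>) :: complex) = expectation (\<lambda>\<omega>. of_real (indicator (Y -` A \<inter> space M) \<omega>))"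
      by (intro Bochner_Integration.integral_cong) (auto simp: indicator_def)
    then show ?thesis by simp
  qed
  have cov: "expectation (\<lambda>\<omega>. iexp (u * X \<omega>) * indicator A (Y \<omega>))
      = expectation (\<lambda>\<omega>. iexp (u * X \<omega>)) * prob (Y -` A \<inter> space M)" for u
  proof -
    let ?c = "expectation (\<lambda>\<omega>. iexp (u * X \<omega>))"
    have "(\<integral>\<omega>. (iexp (u * X \<omega>) - ?c) * indicator A (Y \<omega>) \<partial>M) = 0"
    proof (rule weighted_char_zero_vec[OF _ Y _ A])
      show "integrable M (\<lambda>\<omega>. iexp (u * X \<omega>) - ?c)"
        by (intro Bochner_Integration.integrable_diff integrable_const bounded) auto
      show "(\<integral>\<omega>. (iexp (u * X \<omega>) - ?c) * iexp (t \<bullet> Y \<omega>) \<partial>M) = 0" for t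
      proof -
        have "integrable M (\<lambda>\<omega>. iexp (u * X \<omega>) * iexp (t \<bullet> Y \<omega>))"
          "integrable M (\<lambda>\<omega>. iexp (t \<bullet> Y \<omega>))"
          by (auto intro!: bounded simp: norm_mult)
        then show ?thesis
          unfolding left_diff_distrib
          by (subst Bochner_Integration.integral_diff) (simp_all only: factor integral_mult_right_zero integrable_mult_right_iff, simp_all)
      qed
    qed
    moreover have "integrable M (\<lambda>\<omega>. iexp (u * X \<omega>) * indicator A (Y \<omega>))" "integrable M (\<lambda>\<omega>. indicator A (Y \<omega>) :: complex)"
      by (auto intro!: bounded simp: norm_mult indicator_def)
    ultimately show ?thesis by (simp add: left_diff_distrib indP)
  qed
  let ?p = "prob (Y -` A \<inter> space M)"
  have ihX: "integrable M (\<lambda>\<omega>. indicator A (Y \<omega>) * h (X \<omega>))"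
    by (rule Bochner_Integration.integrable_bound[OF hX]) (auto simp: indicator_def)
  \<comment> \<open>The real lemma is used because it admits unbounded integrable \<open>h\<close>;
    the applications take \<open>h\<close> affine or a centred square.\<close>
  have "(\<integral>\<omega>. (indicator A (Y \<omega>) - ?p) * h (X \<omega>) \<partial>M) = 0"
  proof (rule real_weighted_char_zero[OF _ X _ h])
    show "integrable M (\<lambda>\<omega>. indicator A (Y \<omega>) - ?p)"
      by (intro Bochner_Integration.integrable_diff integrable_const_bound[of _ 1]) (auto simp: indicator_def)
    show "integrable M (\<lambda>\<omega>. (indicator A (Y \<omega>) - ?p) * h (X \<omega>))"
      using ihX hX by (simp add: left_diff_distrib)
    show "(\<integral>\<omega>. of_real (indicator A (Y \<omega>) - ?p) * iexp (s * X \<omega>) \<partial>M) = 0" for s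
    proof -
      have *: "of_real (indicator A (Y \<omega>) - ?p) * iexp (s * X \<omega>)
          = iexp (s * X \<omega>) * indicator A (Y \<omega>) - of_real ?p * iexp (s * X \<omega>)" for \<omega>
        by (auto simp: indicator_def algebra_simps)
      have "integrable M (\<lambda>\<omega>. iexp (s * X \<omega>) * indicator A (Y \<omega>))" "integrable M (\<lambda>\<omega>. iexp (s * X \<omega>))"
        by (auto intro!: bounded simp: norm_mult indicator_def)
      then show ?thesis unfolding * using cov[of s] by simp
    qed
  qed
  then show ?thesis using ihX hX by (simp add: left_diff_distrib)
qed

section \<open>Conditional moments\<close>

lemma borel_measurable_vecI:
  fixes Y :: "'a \<Rightarrow> real^'n"
  assumes "\<And>i. (\<lambda>\<omega>. Y \<omega> $ i) \<in> borel_measurable M"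
  shows "Y \<in> borel_measurable M"
  by (subst borel_measurable_euclidean_space) (auto simp: Basis_vec_def inner_axis assms)

lemma sum_UNIV_sum:
  fixes F :: "'n::finite + 'd::finite \<Rightarrow> 'z::comm_monoid_add"
  shows "(\<Sum>i\<in>UNIV. F i) = (\<Sum>j\<in>UNIV. F (Inl j)) + (\<Sum>k\<in>UNIV. F (Inr k))"
  by (simp add: sum.Plus flip: UNIV_Plus_UNIV)

text \<open>Every event of the sigma-algebra generated by \<open>Y\<close> is a preimage of a Borel
  set, so the averaging property need only be tested against
  \<open>indicator A (Y \<omega>)\<close>.\<close>

lemma (in prob_space) cond_exp_given_charact:
  fixes Y :: "'a \<Rightarrow> real^'n"
  assumes Y[measurable]: "Y \<in> borel_measurable M"
    and Z: "integrable M Z" and w[measurable]: "w \<in> borel_measurable borel" and wY: "integrable M (\<lambda>\<omega>. w (Y \<omega>))"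
    and eq: "\<And>A. A \<in> sets borel \<Longrightarrow>
      (\<integral>\<omega>. indicator A (Y \<omega>) * Z \<omega> \<partial>M) = (\<integral>\<omega>. indicator A (Y \<omega>) * w (Y \<omega>) \<partial>M)"
  shows "AE \<omega> in M. cond_exp_given M Y Z \<omega> = w (Y \<omega>)"
proof -
  let ?F = "vimage_algebra (space M) Y borel"
  have sub: "subalgebra M ?F"
    unfolding subalgebra_def using measurable_sets[OF Y] by (auto simp: sets_vimage_algebra2)
  interpret finite_measure_subalgebra M ?F
    by unfold_locales (rule sub)
  have YF: "Y \<in> measurable ?F borel" by (rule measurable_vimage_algebra1) simp
  show ?thesis
  proof (rule real_cond_exp_charact[OF _ Z wY])
    show "(\<lambda>\<omega>. w (Y \<omega>)) \<in> borel_measurable ?F" using YF w by (rule measurable_compose)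
    fix B assume "B \<in> sets ?F"
    then obtain A where A: "A \<in> sets borel" "B = Y -` A \<inter> space M" by (auto simp: sets_vimage_algebra2)
    have "(\<integral>\<omega>\<in>B. q \<omega> \<partial>M) = (\<integral>\<omega>. indicator A (Y \<omega>) * q \<omega> \<partial>M)" for q :: "'a \<Rightarrow> real"
      unfolding set_lebesgue_integral_def
      by (intro Bochner_Integration.integral_cong) (auto simp: indicator_def A)
    then show "(\<integral>\<omega>\<in>B. Z \<omega> \<partial>M) = (\<integral>\<omega>\<in>B. w (Y \<omega>) \<partial>M)" using eq[OF A(1)] by simp
  qed
qed

section \<open>Pointwise uniqueness of continuous versions\<close>

definition full_support :: "'a measure \<Rightarrow> ('a \<Rightarrow> 'b::topological_space) \<Rightarrow> bool" where
  "full_support M Y \<longleftrightarrow> (\<forall>U. open U \<longrightarrow> U \<noteq> {} \<longrightarrow> emeasure M (Y -` U \<inter> space M) > 0)"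

text \<open>Two continuous maps into a Hausdorff space differ on an open set. If it were nonempty,
  full support would give it positive probability.\<close>

lemma full_support_continuous_eq:
  fixes m m' :: "'b::topological_space \<Rightarrow> 'c::t2_space"
  assumes supp: "full_support M Y" and Y[measurable]: "Y \<in> borel_measurable M"
    and cont: "continuous_on UNIV m" "continuous_on UNIV m'"
    and ae: "AE \<omega> in M. m (Y \<omega>) = m' (Y \<omega>)"
  shows "m = m'"
proof (rule ccontr)
  assume "m \<noteq> m'"
  then have ne: "{y. m y \<noteq> m' y} \<noteq> {}" by auto
  have op: "open {y. m y \<noteq> m' y}" by (rule open_Collect_neq[OF cont])
  then have [measurable]: "{y. m y \<noteq> m' y} \<in> sets borel" by simp
  have "Y -` {y. m y \<noteq> m' y} \<inter> space M \<in> null_sets M"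
    using ae measurable_sets[OF Y \<open>_ \<in> sets borel\<close>]
    by (subst AE_iff_null_sets) (auto elim!: eventually_mono)
  then show False using supp op ne by (force simp: full_support_def null_sets_def)
qed

lemma invertible_matrix_inv:
  fixes A :: "'a::semiring_1^'n^'m"
  assumes "invertible A"
  shows "A ** matrix_inv A = mat 1" "matrix_inv A ** A = mat 1"
  using someI_ex[OF assms[unfolded invertible_def]] by (simp_all add: matrix_inv_def)

section \<open>Regression of \<open>G\<close> on \<open>Y\<close> within one Gaussian model\<close>

locale gaussian_regression = prob_space M
  for M :: "'a measure" and Y :: "'a \<Rightarrow> real^'n" and G :: "'a \<Rightarrow> real^'d"
    and mY mG SYY SYG SGY SGG +
  assumes law: "joint_normal_law M Y G mY mG SYY SYG SGY SGG"
    and inv: "invertible SYY"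
begin

definition "joint p \<omega> = (case p of Inl i \<Rightarrow> Y \<omega> $ i | Inr k \<Rightarrow> G \<omega> $ k)"

definition "joint_cov p q = (case p of
          Inl i \<Rightarrow> (case q of Inl j \<Rightarrow> SYY $ i $ j | Inr l \<Rightarrow> SYG $ i $ l)
        | Inr k \<Rightarrow> (case q of Inl j \<Rightarrow> SGY $ k $ j | Inr l \<Rightarrow> SGG $ k $ l))"

definition "joint_mean p = (case p of Inl i \<Rightarrow> mY $ i | Inr k \<Rightarrow> mG $ k)"

lemma family: "gaussian_family M UNIV joint joint_mean joint_cov"
  using law unfolding joint_normal_law_def joint_def[abs_def] joint_cov_def[abs_def] joint_mean_def[abs_def] .

lemma Y_measurable[measurable]: "Y \<in> borel_measurable M"
  using normal_rvD(1)[OF gaussian_family_single[OF family UNIV_I, of "Inl _"]]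
  by (intro borel_measurable_vecI) (simp add: joint_def[abs_def])

text \<open>The matrix of regression coefficients (the Kalman gain), that is, the solution of the
  normal equations \<open>gain ** SYY = SGY\<close>.\<close>

definition "gain = SGY ** matrix_inv SYY"

lemma gain_SYY: "gain ** SYY = SGY"
  using inv by (simp add: gain_def invertible_matrix_inv(2) flip: matrix_mul_assoc)

text \<open>The uncentred residual written as a single linear combination of the joint family, the
  form that the independence result accepts.\<close>

definition "res_coeff k i = (case i of Inl j \<Rightarrow> - gain $ k $ j | Inr l \<Rightarrow> if l = k then 1 else (0::real))"

lemma sum_res_coeff: "(\<Sum>i\<in>UNIV. res_coeff k i * q i) = q (Inr k) - (\<Sum>j\<in>UNIV. gain $ k $ j * q (Inl j))"
  by (simp add: sum_UNIV_sum res_coeff_def sum_negf if_distrib[of "\<lambda>x. x * _"] cong: if_cong)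

text \<open>The sum is an entry of \<open>SGY - gain ** SYY\<close>, which is zero by the choice of
  the gain.\<close>

lemma res_coeff_orthogonal: "(\<Sum>i\<in>UNIV. res_coeff k i * joint_cov i (Inl j)) = 0"
  using gain_SYY by (simp add: sum_res_coeff joint_cov_def vec_eq_iff matrix_matrix_mult_def)

definition "cov_form b c = (\<Sum>i\<in>UNIV. \<Sum>j\<in>UNIV. b i * c j * joint_cov i j)"

lemma cov_form_commute: "cov_form b c = cov_form c b"
  using family unfolding cov_form_def gaussian_family_def by (subst sum.swap) (simp add: mult_ac)

lemma cov_form_add: "cov_form (\<lambda>i. b i + c i) d = cov_form b d + cov_form c d"
  by (simp add: cov_form_def distrib_right sum.distrib)

text \<open>The residual is uncorrelated with \<open>Y\<close>, so pairing it with another residual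
  leaves only its covariance with \<open>G $ l\<close>. The resulting matrix is the Schur complement
  of \<open>SYY\<close>.\<close>

lemma cov_form_res_coeff: "cov_form (res_coeff k) (res_coeff l) = (SGG - gain ** SYG) $ k $ l"
proof -
  have "cov_form (res_coeff l) (res_coeff k) = (\<Sum>j\<in>UNIV. res_coeff l j * (\<Sum>i\<in>UNIV. res_coeff k i * joint_cov i j))"
    using family unfolding cov_form_def gaussian_family_def by (simp add: sum_distrib_left mult_ac)
  also have "\<dots> = (SGG - gain ** SYG) $ k $ l"
    unfolding sum_res_coeff[of l] res_coeff_orthogonal by (simp add: sum_res_coeff joint_cov_def matrix_matrix_mult_def)
  finally show ?thesis by (simp add: cov_form_commute)
qed

definition "residual k \<omega> = G \<omega> $ k - (mG + gain *v (Y \<omega> - mY)) $ k"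

lemma residual_eq: "residual k \<omega> = (\<Sum>i\<in>UNIV. res_coeff k i * joint i \<omega>) - (\<Sum>i\<in>UNIV. res_coeff k i * joint_mean i)"
  by (simp add: residual_def sum_res_coeff joint_def joint_mean_def matrix_vector_mult_def sum_subtractf right_diff_distrib)

lemma residual_integrable: "integrable M (residual k)"
  unfolding residual_eq[abs_def]
  using normal_rv_moments(1)[OF gaussian_family_sum[OF family], of "res_coeff k"] by simp

lemma residual_orthogonal:
  assumes "A \<in> sets borel"
  shows "(\<integral>\<omega>. indicator A (Y \<omega>) * residual k \<omega> \<partial>M) = 0"
proof -
  let ?c = "\<Sum>i\<in>UNIV. res_coeff k i * joint_mean i"
  note N = normal_rv_moments[OF gaussian_family_sum[OF family, of "res_coeff k"]]
  have "(\<integral>\<omega>. indicator A (Y \<omega>) * (\<lambda>x. x - ?c) (\<Sum>i\<in>UNIV. res_coeff k i * joint i \<omega>) \<partial>M) =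
     prob (Y -` A \<inter> space M) * expectation (\<lambda>\<omega>. (\<lambda>x. x - ?c) (\<Sum>i\<in>UNIV. res_coeff k i * joint i \<omega>))"
    using N(1)
    by (intro gaussian_family_uncorrelated_indep[OF family Y_measurable _ _ assms, of Inl])
      (auto simp: joint_def res_coeff_orthogonal)
  then show ?thesis using N(1,3) by (simp add: residual_eq prob_space)
qed

text \<open>Independence applied to the centred square, whose expectation is the variance. The
  coefficients are general because polarization uses both \<open>res_coeff k\<close> and a sum of
  two such vectors.\<close>

lemma square_indep:
  assumes "A \<in> sets borel" and b: "\<And>j. (\<Sum>i\<in>UNIV. b i * joint_cov i (Inl j)) = 0"
  shows "(\<integral>\<omega>. indicator A (Y \<omega>) * ((\<Sum>i\<in>UNIV. b i * joint i \<omega>) - (\<Sum>i\<in>UNIV. b i * joint_mean i))\<^sup>2 \<partial>M)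
      = prob (Y -` A \<inter> space M) * cov_form b b"
proof -
  let ?c = "\<Sum>i\<in>UNIV. b i * joint_mean i"
  note N = normal_rv_moments[OF gaussian_family_sum[OF family, of b]]
  have "(\<integral>\<omega>. indicator A (Y \<omega>) * (\<lambda>x. (x - ?c)\<^sup>2) (\<Sum>i\<in>UNIV. b i * joint i \<omega>) \<partial>M) =
     prob (Y -` A \<inter> space M) * expectation (\<lambda>\<omega>. (\<lambda>x. (x - ?c)\<^sup>2) (\<Sum>i\<in>UNIV. b i * joint i \<omega>))"
    using N(2)
    by (intro gaussian_family_uncorrelated_indep[OF family Y_measurable _ _ assms(1), of Inl])
      (auto simp: joint_def b)
  then show ?thesis using N(4) by (simp add: cov_form_def)
qed

lemma integrable_indicator_Y:
  fixes q :: "'a \<Rightarrow> real"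
  assumes q: "integrable M q" and [measurable]: "A \<in> sets borel"
  shows "integrable M (\<lambda>\<omega>. indicator A (Y \<omega>) * q \<omega>)"
  using q by (rule Bochner_Integration.integrable_bound) (use q in \<open>auto simp: indicator_def\<close>)

text \<open>Independence of \<open>Y\<close> is established for functions of one linear combination;
  this identity expresses a product of two residuals through such functions.\<close>

lemma residual_polarization:
  "residual k \<omega> * residual l \<omega> =
    ((residual k \<omega> + residual l \<omega>)\<^sup>2 - (residual k \<omega>)\<^sup>2 - (residual l \<omega>)\<^sup>2) / 2"
  by (simp add: power2_sum)

lemma residual_add:
  "residual k \<omega> + residual l \<omega> =
    (\<Sum>i\<in>UNIV. (res_coeff k i + res_coeff l i) * joint i \<omega>) - (\<Sum>i\<in>UNIV. (res_coeff k i + res_coeff l i) * joint_mean i)"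
  by (simp add: residual_eq distrib_right sum.distrib)

lemma residual_square_integrable:
  "integrable M (\<lambda>\<omega>. (residual k \<omega>)\<^sup>2)"
  "integrable M (\<lambda>\<omega>. (residual k \<omega> + residual l \<omega>)\<^sup>2)"
  unfolding residual_add unfolding residual_eq by (rule normal_rv_moments(2)[OF gaussian_family_sum[OF family]])+

lemma residual_product_integrable: "integrable M (\<lambda>\<omega>. residual k \<omega> * residual l \<omega>)"
  unfolding residual_polarization using residual_square_integrable by simp

lemma residual_product:
  assumes A[measurable]: "A \<in> sets borel"
  shows "(\<integral>\<omega>. indicator A (Y \<omega>) * (residual k \<omega> * residual l \<omega>) \<partial>M)
    = prob (Y -` A \<inter> space M) * (SGG - gain ** SYG) $ k $ l"
proof -
  let ?p = "prob (Y -` A \<inter> space M)"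
  let ?b = "\<lambda>i. res_coeff k i + res_coeff l i"
  have sum: "cov_form ?b ?b = cov_form (res_coeff k) (res_coeff k) + cov_form (res_coeff l) (res_coeff l)
      + 2 * cov_form (res_coeff k) (res_coeff l)"
  proof -
    have "cov_form ?b ?b = cov_form (res_coeff k) ?b + cov_form (res_coeff l) ?b" by (rule cov_form_add)
    also have "cov_form (res_coeff k) ?b = cov_form (res_coeff k) (res_coeff k) + cov_form (res_coeff l) (res_coeff k)"
      unfolding cov_form_commute[of "res_coeff k" ?b] by (rule cov_form_add)
    also have "cov_form (res_coeff l) ?b = cov_form (res_coeff k) (res_coeff l) + cov_form (res_coeff l) (res_coeff l)"
      unfolding cov_form_commute[of "res_coeff l" ?b] by (rule cov_form_add)
    finally show ?thesis using cov_form_commute[of "res_coeff l" "res_coeff k"] by simp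
  qed
  have s: "(\<integral>\<omega>. indicator A (Y \<omega>) * (residual k \<omega>)\<^sup>2 \<partial>M) = ?p * cov_form (res_coeff k) (res_coeff k)" for k
    unfolding residual_eq by (rule square_indep[OF A res_coeff_orthogonal])
  have s2: "(\<integral>\<omega>. indicator A (Y \<omega>) * (residual k \<omega> + residual l \<omega>)\<^sup>2 \<partial>M) = ?p * cov_form ?b ?b"
    unfolding residual_add by (rule square_indep[OF A]) (simp add: distrib_right sum.distrib res_coeff_orthogonal)
  have split: "indicator A (Y \<omega>) * (residual k \<omega> * residual l \<omega>) = (indicator A (Y \<omega>) * (residual k \<omega> + residual l \<omega>)\<^sup>2
     - indicator A (Y \<omega>) * (residual k \<omega>)\<^sup>2 - indicator A (Y \<omega>) * (residual l \<omega>)\<^sup>2) / 2" for \<omega>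
    unfolding residual_polarization by (simp only: right_diff_distrib times_divide_eq_right)
  note int = integrable_indicator_Y[OF residual_square_integrable(1)[of k] A]
    integrable_indicator_Y[OF residual_square_integrable(1)[of l] A]
    integrable_indicator_Y[OF residual_square_integrable(2)[of k l] A]
  have "(\<integral>\<omega>. indicator A (Y \<omega>) * (residual k \<omega> * residual l \<omega>) \<partial>M) =
    (?p * cov_form ?b ?b - ?p * cov_form (res_coeff k) (res_coeff k) - ?p * cov_form (res_coeff l) (res_coeff l)) / 2"
    unfolding split using int
    by (simp only: integral_divide_zero Bochner_Integration.integral_diff
        Bochner_Integration.integrable_diff s s2)
  also have "\<dots> = ?p * cov_form (res_coeff k) (res_coeff l)" unfolding sum by (simp add: algebra_simps)
  finally show ?thesis by (simp add: cov_form_res_coeff)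
qed

lemma continuous_regression: "continuous_on UNIV (\<lambda>y. mG + gain *v (y - mY))"
  by (intro continuous_intros continuous_on_compose2[OF matrix_vector_mult_linear_continuous_on]) auto

text \<open>\<open>G\<close> is its regression on \<open>Y\<close> plus the residual, and the
  residual integrates to zero over every event of \<open>Y\<close>.\<close>

lemma cond_exp_G: "AE \<omega> in M. cond_exp_given M Y (\<lambda>\<omega>. G \<omega> $ k) \<omega> = (mG + gain *v (Y \<omega> - mY)) $ k"
proof (rule cond_exp_given_charact[OF Y_measurable, where w = "\<lambda>y. (mG + gain *v (y - mY)) $ k"])
  show G: "integrable M (\<lambda>\<omega>. G \<omega> $ k)"
    using normal_rv_moments(1)[OF gaussian_family_single[OF family UNIV_I, of "Inr k"]]
    by (simp add: joint_def[abs_def])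
  show w: "(\<lambda>y. (mG + gain *v (y - mY)) $ k) \<in> borel_measurable borel"
    by (intro borel_measurable_continuous_onI continuous_intros continuous_regression)
  have w_eq: "(mG + gain *v (Y \<omega> - mY)) $ k = G \<omega> $ k - residual k \<omega>" for \<omega> by (simp add: residual_def)
  show "integrable M (\<lambda>\<omega>. (mG + gain *v (Y \<omega> - mY)) $ k)"
    unfolding w_eq using G residual_integrable by simp
  fix A :: "(real^'n) set" assume A: "A \<in> sets borel"
  show "(\<integral>\<omega>. indicator A (Y \<omega>) * G \<omega> $ k \<partial>M) = (\<integral>\<omega>. indicator A (Y \<omega>) * (mG + gain *v (Y \<omega> - mY)) $ k \<partial>M)"
    unfolding w_eq right_diff_distrib using integrable_indicator_Y[OF G A] integrable_indicator_Y[OF residual_integrable A]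
      residual_orthogonal[OF A] by simp
qed

text \<open>The version \<open>w\<close> is constant since the residuals are independent of
  \<open>Y\<close>: a Gaussian conditional covariance does not depend on the observed value.\<close>

lemma cond_exp_residual_product:
  "AE \<omega> in M. cond_exp_given M Y (\<lambda>\<omega>. residual k \<omega> * residual l \<omega>) \<omega> = (SGG - gain ** SYG) $ k $ l"
proof (rule cond_exp_given_charact[OF Y_measurable residual_product_integrable, where w = "\<lambda>_. (SGG - gain ** SYG) $ k $ l"])
  fix A :: "(real^'n) set" assume A[measurable]: "A \<in> sets borel"
  have "(\<integral>\<omega>. indicator A (Y \<omega>) \<partial>M) = (\<integral>\<omega>. indicat_real (Y -` A \<inter> space M) \<omega> \<partial>M)"
    by (intro Bochner_Integration.integral_cong) (auto simp: indicator_def)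
  then show "(\<integral>\<omega>. indicator A (Y \<omega>) * (residual k \<omega> * residual l \<omega>) \<partial>M)
    = (\<integral>\<omega>. indicator A (Y \<omega>) * (SGG - gain ** SYG) $ k $ l \<partial>M)"
    unfolding residual_product[OF A] by simp
qed auto

context
  assumes supp: "full_support M Y"
begin

text \<open>Any competing version agrees with the regression function almost surely at
  \<open>Y\<close>, first in each of the finitely many components and then as a vector; full support
  makes the functions equal everywhere.\<close>

lemma cond_mean_eq: "cond_mean M Y G = (\<lambda>y. mG + gain *v (y - mY))"
  unfolding cond_mean_def
proof (rule the_equality)
  show "continuous_on UNIV (\<lambda>y. mG + gain *v (y - mY)) \<and>
     (\<forall>k. AE \<omega> in M. cond_exp_given M Y (\<lambda>\<omega>. G \<omega> $ k) \<omega> = (mG + gain *v (Y \<omega> - mY)) $ k)"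
    using continuous_regression cond_exp_G by blast
  fix m' assume m': "continuous_on UNIV m' \<and>
     (\<forall>k. AE \<omega> in M. cond_exp_given M Y (\<lambda>\<omega>. G \<omega> $ k) \<omega> = m' (Y \<omega>) $ k)"
  have "AE \<omega> in M. m' (Y \<omega>) $ k = (mG + gain *v (Y \<omega> - mY)) $ k" for k
    using m'[THEN conjunct2, rule_format, of k] cond_exp_G[of k] by eventually_elim simp
  then have "AE \<omega> in M. m' (Y \<omega>) = mG + gain *v (Y \<omega> - mY)"
    by (simp only: vec_eq_iff AE_all_countable) blast
  then show "m' = (\<lambda>y. mG + gain *v (y - mY))"
    using m' by (intro full_support_continuous_eq[OF supp Y_measurable _ continuous_regression]) auto
qed

lemma cond_cov_eq: "cond_cov M Y G = (\<lambda>y. SGG - gain ** SYG)"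
proof -
  \<comment> \<open>The value of \<open>cond_mean\<close> is already known, so the mean nested in
    \<open>cond_cov\<close> can be replaced by the explicit residual.\<close>
  have centred: "G \<omega> $ k - cond_mean M Y G (Y \<omega>) $ k = residual k \<omega>" for k \<omega>
    by (simp add: cond_mean_eq residual_def)
  show ?thesis unfolding cond_cov_def centred
  proof (rule the_equality)
    show "continuous_on UNIV (\<lambda>y::real^'n. SGG - gain ** SYG) \<and>
       (\<forall>k l. AE \<omega> in M. cond_exp_given M Y (\<lambda>\<omega>. residual k \<omega> * residual l \<omega>) \<omega> = (SGG - gain ** SYG) $ k $ l)"
      using cond_exp_residual_product by simp
    fix S assume S: "continuous_on UNIV S \<and>
       (\<forall>k l. AE \<omega> in M. cond_exp_given M Y (\<lambda>\<omega>. residual k \<omega> * residual l \<omega>) \<omega> = S (Y \<omega>) $ k $ l)"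
    have "AE \<omega> in M. S (Y \<omega>) $ k $ l = (SGG - gain ** SYG) $ k $ l" for k l
      using S[THEN conjunct2, rule_format, of k l] cond_exp_residual_product[of k l] by eventually_elim simp
    then have "AE \<omega> in M. S (Y \<omega>) = SGG - gain ** SYG"
      by (simp only: vec_eq_iff AE_all_countable) blast
    then show "S = (\<lambda>y. SGG - gain ** SYG)"
      using S by (intro full_support_continuous_eq[OF supp Y_measurable]) auto
  qed
qed

end

end

section \<open>Coercive matrices\<close>

lemma tendsto_matrix_mult:
  fixes A :: "'a \<Rightarrow> real^'n^'m" and B :: "'a \<Rightarrow> real^'k^'n"
  assumes "(A \<longlongrightarrow> a) F" "(B \<longlongrightarrow> b) F"
  shows "((\<lambda>x. A x ** B x) \<longlongrightarrow> a ** b) F"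
  unfolding matrix_matrix_mult_def using assms by (intro tendsto_intros)

lemma tendsto_matrix_vector_mult:
  fixes A :: "'a \<Rightarrow> real^'n^'m"
  assumes "(A \<longlongrightarrow> a) F" "(v \<longlongrightarrow> w) F"
  shows "((\<lambda>x. A x *v v x) \<longlongrightarrow> a *v w) F"
  unfolding matrix_vector_mult_def using assms by (intro tendsto_intros)

text \<open>The bound \<open>S \<ge> s I\<close> in terms of quadratic forms: these are the
  variances of linear combinations, and the condition is closed under limits.\<close>

definition coercive :: "real \<Rightarrow> real^'n^'n \<Rightarrow> bool" where
  "coercive s S \<longleftrightarrow> (\<forall>a. s * (a \<bullet> a) \<le> a \<bullet> (S *v a))"

text \<open>Cauchy-Schwarz, divided by \<open>norm a\<close>. For \<open>s > 0\<close> it makes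
  \<open>S\<close> injective and bounds its inverse by \<open>1 / s\<close>.\<close>

lemma coercive_norm_le:
  assumes "coercive s S"
  shows "s * norm a \<le> norm (S *v a)"
proof (cases "a = 0")
  case False
  have "s * norm a * norm a \<le> a \<bullet> (S *v a)"
    using assms by (simp add: coercive_def dot_square_norm power2_eq_square mult.assoc)
  also have "\<dots> \<le> norm (S *v a) * norm a"
    using norm_cauchy_schwarz[of a "S *v a"] by (simp add: mult.commute)
  finally show ?thesis using False by simp
qed simp

lemma coercive_invertible:
  assumes "coercive s S" "s > 0"
  shows "invertible S"
proof -
  have "a = 0" if "S *v a = 0" for a
    using coercive_norm_le[OF assms(1), of a] assms(2) that
    by (simp add: mult_le_0_iff)
  then show ?thesis
    by (simp add: invertible_left_inverse matrix_left_invertible_ker)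
qed

lemma coercive_limit:
  assumes "\<And>l. coercive s (S' l)" "S' \<longlonglongrightarrow> S"
  shows "coercive s S"
  unfolding coercive_def
proof
  fix a
  have "(\<lambda>l. a \<bullet> (S' l *v a)) \<longlonglongrightarrow> a \<bullet> (S *v a)"
    by (intro tendsto_intros tendsto_matrix_vector_mult assms)
  then show "s * (a \<bullet> a) \<le> a \<bullet> (S *v a)"
    by (rule LIMSEQ_le_const) (use assms(1) in \<open>auto simp: coercive_def\<close>)
qed

text \<open>With \<open>u = matrix_inv S *v w\<close>, applying \<open>S' l\<close> to the error
  \<open>matrix_inv (S' l) *v w - u\<close> gives \<open>S *v u - S' l *v u\<close>, which tends to
  zero. The common constant \<open>s\<close> converts this into convergence of the error
  itself.\<close>

lemma tendsto_matrix_inv_coercive: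
  fixes S :: "real^'n^'n"
  assumes S': "\<And>l. coercive s (S' l)" and s: "s > 0" and lim: "S' \<longlonglongrightarrow> S"
  shows "(\<lambda>l. matrix_inv (S' l)) \<longlonglongrightarrow> matrix_inv S"
proof -
  note inv = invertible_matrix_inv[OF coercive_invertible[OF coercive_limit[OF S' lim] s]]
  note inv' = invertible_matrix_inv[OF coercive_invertible[OF S' s]]
  have "(\<lambda>l. matrix_inv (S' l) *v w) \<longlonglongrightarrow> matrix_inv S *v w" for w
  proof -
    let ?u = "matrix_inv S *v w"
    have "norm (matrix_inv (S' l) *v w - ?u) \<le> norm (S *v ?u - S' l *v ?u) / s" for l
    proof -
      have "S' l *v (matrix_inv (S' l) *v w - ?u) = S *v ?u - S' l *v ?u"
        by (simp add: matrix_vector_mult_diff_distrib matrix_vector_mul_assoc inv inv')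
      then have "s * norm (matrix_inv (S' l) *v w - ?u) \<le> norm (S *v ?u - S' l *v ?u)"
        using coercive_norm_le[OF S', of "matrix_inv (S' l) *v w - ?u" l] by (simp only:)
      then show ?thesis using s by (simp add: pos_le_divide_eq mult.commute)
    qed
    then have bound: "\<forall>\<^sub>F l in sequentially. norm (matrix_inv (S' l) *v w - ?u) \<le> norm (S *v ?u - S' l *v ?u) / s"
      by (rule always_eventually[OF allI])
    have "(\<lambda>l. norm (S *v ?u - S' l *v ?u) / s) \<longlonglongrightarrow> norm (S *v ?u - S *v ?u) / s"
      using s by (intro tendsto_divide tendsto_norm tendsto_diff tendsto_matrix_vector_mult lim tendsto_const) auto
    then have "(\<lambda>l. norm (S *v ?u - S' l *v ?u) / s) \<longlonglongrightarrow> 0"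
      by (simp only: diff_self norm_zero div_0)
    with bound have "(\<lambda>l. matrix_inv (S' l) *v w - ?u) \<longlonglongrightarrow> 0"
      by (rule Lim_null_comparison)
    then show ?thesis by (rule LIM_zero_cancel)
  qed
  \<comment> \<open>Convergence on the axis vectors is convergence of the columns, hence of all
    entries.\<close>
  from tendsto_vec_nth[OF this[of "axis _ 1"]] show ?thesis
    by (intro vec_tendstoI) (simp add: matrix_vector_mult_basis column_def)
qed

section \<open>Observations with independent noise\<close>

lemma family_sigma_measurable:
  assumes "j \<in> T"
  shows "X j \<in> borel_measurable (family_sigma M T X)"
proof -
  have "(\<lambda>\<omega>. \<lambda>i\<in>T. X i \<omega>) \<in> measurable (family_sigma M T X) (\<Pi>\<^sub>M i\<in>T. borel)"
    unfolding family_sigma_def by (rule measurable_vimage_algebra1) (auto simp: space_PiM)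
  from measurable_compose[OF this measurable_component_singleton[OF assms]] show ?thesis
    using assms by simp
qed

text \<open>The sigma-algebras generated by \<open>U\<close> and \<open>V\<close> lie inside those
  of the two families, and independence passes to subcollections.\<close>

lemma (in prob_space) indep_families_indep_var:
  fixes U V :: "'a \<Rightarrow> real"
  assumes ind: "indep_families M S X T Z"
    and U: "U \<in> borel_measurable (family_sigma M S X)" and V: "V \<in> borel_measurable (family_sigma M T Z)"
  shows "indep_var borel U borel V"
proof -
  have ind': "indep_set (sets (family_sigma M S X)) (sets (family_sigma M T Z))"
    using ind by (simp add: indep_families_def)
  have sp: "space (family_sigma M S X) = space M" "space (family_sigma M T Z) = space M"
    by (simp_all add: family_sigma_def)
  have sub: "{W -` A \<inter> space M |A. A \<in> sets borel} \<subseteq> sets F"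
    if "W \<in> borel_measurable F" "space F = space M" for W :: "'a \<Rightarrow> real" and F
    using measurable_sets[OF that(1)] that(2) by auto
  have "U \<in> borel_measurable M" "V \<in> borel_measurable M"
    using U V indep_setD_ev1[OF ind'] indep_setD_ev2[OF ind'] sp by (auto simp: measurable_def)
  moreover have "indep_set (sigma_sets (space M) {U -` A \<inter> space M |A. A \<in> sets borel})
      (sigma_sets (space M) {V -` A \<inter> space M |A. A \<in> sets borel})"
    using ind' unfolding indep_set_def
    by (rule indep_sets_mono_sets)
      (use sets.sigma_sets_subset[OF sub[OF U sp(1)]] sets.sigma_sets_subset[OF sub[OF V sp(2)]] sp
        in \<open>auto split: bool.splits\<close>)
  ultimately show ?thesis by (simp add: indep_var_eq)
qed

text \<open>A normal density is strictly positive, so an interval of probability zero would be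
  Lebesgue-null.\<close>

lemma normal_rv_interval:
  assumes X: "normal_rv M X m v" and v: "v > 0" and "\<alpha> < \<beta>"
  shows "emeasure M (X -` {\<alpha><..<\<beta>} \<inter> space M) > 0"
proof (rule ccontr)
  assume "\<not> ?thesis"
  then have "emeasure (distr M borel X) {\<alpha><..<\<beta>} = 0"
    using normal_rvD(1)[OF X] by (simp add: emeasure_distr)
  then have "{\<alpha><..<\<beta>} \<in> null_sets (density lborel (normal_density m (sqrt v)))"
    using X v by (simp add: normal_rv_def null_sets_def)
  then have "AE x in lborel. x \<in> {\<alpha><..<\<beta>} \<longrightarrow> ennreal (normal_density m (sqrt v) x) = 0"
    by (subst (asm) null_sets_density_iff) auto
  then have "AE x in lborel. x \<notin> {\<alpha><..<\<beta>}"
  proof eventually_elim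
    case (elim x)
    have "normal_density m (sqrt v) x > 0" using v by (intro normal_density_pos) simp
    then show ?case using elim by (auto simp: ennreal_eq_0_iff)
  qed
  then have "{\<alpha><..<\<beta>} \<in> null_sets lborel"
    by (subst AE_iff_null_sets) auto
  then show False using \<open>\<alpha> < \<beta>\<close> by (simp add: null_sets_def)
qed

text \<open>The observed signals \<open>X i\<close> are members of the larger family
  \<open>Z\<close>, because independence of the noise is formulated against all evaluations of the
  ensemble.\<close>

locale noisy_observation = prob_space M
  for M :: "'a measure" and X :: "'n::finite \<Rightarrow> 'a \<Rightarrow> real" and \<epsilon> :: "'n \<Rightarrow> 'a \<Rightarrow> real"
    and v :: real and T :: "'q set" and Z :: "'q \<Rightarrow> 'a \<Rightarrow> real" and q :: "'n \<Rightarrow> 'q" +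
  assumes noise: "gaussian_noise M \<epsilon> v T Z"
    and v_pos: "v > 0"
    and q: "q i \<in> T" and XZ: "X i = Z (q i)"
begin

lemma noise_normal: "normal_rv M (\<epsilon> i) 0 v"
  using noise by (simp add: gaussian_noise_def)

lemma indep: "indep_families M UNIV \<epsilon> T Z"
  using noise by (simp add: gaussian_noise_def)

lemma noise_measurable[measurable]: "\<epsilon> i \<in> borel_measurable M"
  using normal_rvD(1)[OF noise_normal] .

lemma X_family[measurable]: "X i \<in> borel_measurable (family_sigma M T Z)"
  unfolding XZ by (rule family_sigma_measurable[OF q])

lemma noise_family[measurable]: "\<epsilon> i \<in> borel_measurable (family_sigma M UNIV \<epsilon>)"
  by (rule family_sigma_measurable) simp

lemma X_measurable[measurable]: "X i \<in> borel_measurable M"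
  using indep_var_rv2[OF indep_families_indep_var[OF indep noise_family X_family]] .

lemma noise_char:
  "cmod (expectation (\<lambda>\<omega>. iexp (\<Sum>i\<in>UNIV. a $ i * \<epsilon> i \<omega>))) = exp (- (v * (a \<bullet> a)) / 2)"
proof -
  have ind: "indep_vars (\<lambda>_. borel) (\<lambda>i \<omega>. a $ i * \<epsilon> i \<omega>) UNIV"
    using noise by (intro indep_vars_compose2[where Y = "\<lambda>i x. a $ i * x"]) (auto simp: gaussian_noise_def)
  have single: "char (distr M borel (\<lambda>\<omega>. a $ i * \<epsilon> i \<omega>)) 1 = exp (- ((a $ i)\<^sup>2 * v) / 2)" for i
    using normal_rv_moments(5)[OF noise_normal, of "a $ i"] by (simp add: char_def integral_distr)
  have "expectation (\<lambda>\<omega>. iexp (\<Sum>i\<in>UNIV. a $ i * \<epsilon> i \<omega>))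
      = (\<Prod>i\<in>UNIV. char (distr M borel (\<lambda>\<omega>. a $ i * \<epsilon> i \<omega>)) 1)"
    using char_distr_sum[OF ind, of 1] by (simp add: char_def integral_distr)
  also have "\<dots> = exp (\<Sum>i\<in>UNIV. - ((a $ i)\<^sup>2 * v) / 2)"
    unfolding single by (simp add: exp_sum)
  also have "(\<Sum>i\<in>UNIV. - ((a $ i)\<^sup>2 * v) / 2) = - (v * (a \<bullet> a)) / 2"
    by (simp add: inner_vec_def power2_eq_square mult.commute sum_negf flip: sum_divide_distrib sum_distrib_left sum_distrib_right)
  finally show ?thesis
    by (simp only: norm_of_real abs_exp_cancel)
qed

text \<open>The modulus of the characteristic function of a sum of independent variables is at most that
  of one summand; for the Gaussian laws of \<open>X + \<epsilon>\<close> and \<open>\<epsilon>\<close> this compares the covariances.\<close>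

lemma coercive_covariance:
  assumes gf: "\<And>a. normal_rv M (\<lambda>\<omega>. \<Sum>i\<in>UNIV. a $ i * (X i \<omega> + \<epsilon> i \<omega>)) (c a) (a \<bullet> (S *v a))"
  shows "coercive v S"
  unfolding coercive_def
proof
  fix a
  let ?U = "\<lambda>\<omega>. \<Sum>i\<in>UNIV. a $ i * \<epsilon> i \<omega>" and ?V = "\<lambda>\<omega>. \<Sum>i\<in>UNIV. a $ i * X i \<omega>"
  have "indep_var borel ?U borel ?V"
    by (rule indep_families_indep_var[OF indep]) measurable
  from char_distr_add[OF this, of 1]
  have "expectation (\<lambda>\<omega>. iexp (?U \<omega> + ?V \<omega>)) = expectation (\<lambda>\<omega>. iexp (?U \<omega>)) * char (distr M borel ?V) 1"
    by (simp add: char_def integral_distr)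
  then have "cmod (expectation (\<lambda>\<omega>. iexp (?U \<omega> + ?V \<omega>)))
      = exp (- (v * (a \<bullet> a)) / 2) * cmod (char (distr M borel ?V) 1)"
    by (simp only: norm_mult noise_char)
  also have "\<dots> \<le> exp (- (v * (a \<bullet> a)) / 2)"
  proof -
    interpret V: real_distribution "distr M borel ?V" by (rule real_distribution_distr) measurable
    show ?thesis using V.cmod_char_le_1[of 1] by simp
  qed
  \<comment> \<open>The factor \<open>1\<close> puts the expectation into the shape of the normal
    characteristic function at \<open>t = 1\<close>.\<close>
  also have "(\<lambda>\<omega>. iexp (?U \<omega> + ?V \<omega>)) = (\<lambda>\<omega>. iexp (1 * (\<Sum>i\<in>UNIV. a $ i * (X i \<omega> + \<epsilon> i \<omega>))))"
    by (simp add: distrib_left sum.distrib add.commute)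
  finally have "exp (- (a \<bullet> (S *v a)) / 2) \<le> exp (- (v * (a \<bullet> a)) / 2)"
    unfolding normal_rv_moments(5)[OF gf] by (simp add: norm_mult)
  then show "v * (a \<bullet> a) \<le> a \<bullet> (S *v a)" by simp
qed

text \<open>Some cell \<open>C k\<close> of a fine grid contains \<open>X\<close> with positive probability; there, noise in the
  independent event \<open>D k\<close> moves \<open>X\<close> into the given ball.\<close>

lemma full_support_obs: "full_support M (\<lambda>\<omega>. \<chi> i. X i \<omega> + \<epsilon> i \<omega>)"
  unfolding full_support_def
proof (intro allI impI)
  fix U :: "(real^'n) set" assume "open U" "U \<noteq> {}"
  then obtain y e where e: "e > 0" "ball y e \<subseteq> U" by (meson ex_in_conv openE)
  \<comment> \<open>The Euclidean norm is at most the sum of the absolute coordinates, so coordinate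
    errors below \<open>\<delta>\<close> add up to less than \<open>e\<close>.\<close>
  define \<delta> where "\<delta> = e / CARD('n)"
  have \<delta>: "\<delta> > 0" using e by (simp add: \<delta>_def)
  define C where "C k = {\<omega>\<in>space M. \<forall>i. X i \<omega> \<in> {of_int (k i) * \<delta> ..< (of_int (k i) + 1) * \<delta>}}"
    for k :: "'n \<Rightarrow> int"
  \<comment> \<open>The interval is chosen so that adding a signal value from the cell
    \<open>k\<close> always lands strictly between \<open>y $ i - \<delta>\<close> and
    \<open>y $ i + \<delta>\<close>.\<close>
  define D where "D k = {\<omega>\<in>space M. \<forall>i. \<epsilon> i \<omega> \<in> {y $ i - of_int (k i) * \<delta> - \<delta> <..< y $ i - of_int (k i) * \<delta>}}"
    for k :: "'n \<Rightarrow> int"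
  have C_family: "C k \<in> sets (family_sigma M T Z)" for k
  proof -
    have "C k = {\<omega>\<in>space (family_sigma M T Z). \<forall>i. X i \<omega> \<in> {of_int (k i) * \<delta> ..< (of_int (k i) + 1) * \<delta>}}"
      by (simp add: C_def family_sigma_def)
    then show ?thesis by simp
  qed
  have D_family: "D k \<in> sets (family_sigma M UNIV \<epsilon>)" for k
  proof -
    have "D k = {\<omega>\<in>space (family_sigma M UNIV \<epsilon>). \<forall>i. \<epsilon> i \<omega> \<in> {y $ i - of_int (k i) * \<delta> - \<delta> <..< y $ i - of_int (k i) * \<delta>}}"
      by (simp add: D_def family_sigma_def)
    then show ?thesis by simp
  qed
  have CM: "C k \<in> events" for k unfolding C_def by measurable
  \<comment> \<open>There are only countably many integer index vectors, and their cells cover the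
    space; they cannot all be null.\<close>
  obtain k where "prob (C k) \<noteq> 0"
  proof (rule ccontr)
    assume "\<not> thesis"
    with that have "prob (C k) = 0" for k by blast
    then have "(\<Union>k. C k) \<in> null_sets M"
      by (intro null_sets_UN) (simp add: null_sets_def CM emeasure_eq_measure)
    moreover have "(\<Union>k. C k) = space M"
    proof
      show "space M \<subseteq> (\<Union>k. C k)"
      proof
        fix \<omega> assume "\<omega> \<in> space M"
        then have "\<omega> \<in> C (\<lambda>i. \<lfloor>X i \<omega> / \<delta>\<rfloor>)"
          using \<delta> floor_divide_lower[OF \<delta>] floor_divide_upper[OF \<delta>] by (simp add: C_def)
        then show "\<omega> \<in> (\<Union>k. C k)" by blast
      qed
    qed (auto simp: C_def)
    ultimately show False using emeasure_space_1 by (simp add: null_sets_def)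
  qed
  then have Ck: "prob (C k) > 0" by (simp add: order_less_le)
  have "prob (D k) > 0"
  proof -
    have "D k = (\<Inter>i\<in>UNIV. \<epsilon> i -` {y $ i - of_int (k i) * \<delta> - \<delta> <..< y $ i - of_int (k i) * \<delta>} \<inter> space M)"
      by (auto simp: D_def)
    also have "prob \<dots> = (\<Prod>i\<in>UNIV. prob (\<epsilon> i -` {y $ i - of_int (k i) * \<delta> - \<delta> <..< y $ i - of_int (k i) * \<delta>} \<inter> space M))"
      using noise by (intro indep_varsD) (auto simp: gaussian_noise_def)
    also have "\<dots> > 0"
      using normal_rv_interval[OF noise_normal v_pos] \<delta>
      by (intro prod_pos) (simp add: emeasure_eq_measure)
    finally show ?thesis .
  qed
  moreover have "prob (D k \<inter> C k) = prob (D k) * prob (C k)"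
    using indep D_family C_family unfolding indep_families_def by (rule indep_setD)
  ultimately have "prob (D k \<inter> C k) > 0" using Ck by simp
  also have "prob (D k \<inter> C k) \<le> prob ((\<lambda>\<omega>. \<chi> i. X i \<omega> + \<epsilon> i \<omega>) -` U \<inter> space M)"
  proof (rule finite_measure_mono)
    show "(\<lambda>\<omega>. \<chi> i. X i \<omega> + \<epsilon> i \<omega>) -` U \<inter> space M \<in> events"
      using \<open>open U\<close> by (intro measurable_sets[OF borel_measurable_vecI]) auto
    show "D k \<inter> C k \<subseteq> (\<lambda>\<omega>. \<chi> i. X i \<omega> + \<epsilon> i \<omega>) -` U \<inter> space M"
    proof
      fix \<omega> assume \<omega>: "\<omega> \<in> D k \<inter> C k"
      let ?z = "\<chi> i. X i \<omega> + \<epsilon> i \<omega>"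
      have "\<bar>(?z - y) $ i\<bar> < \<delta>" for i
      proof -
        have "y $ i - of_int (k i) * \<delta> - \<delta> < \<epsilon> i \<omega>" "\<epsilon> i \<omega> < y $ i - of_int (k i) * \<delta>"
          "of_int (k i) * \<delta> \<le> X i \<omega>" "X i \<omega> < of_int (k i) * \<delta> + \<delta>"
          using \<omega> by (auto simp: C_def D_def distrib_right)
        then show ?thesis by simp
      qed
      then have "(\<Sum>i\<in>UNIV. \<bar>(?z - y) $ i\<bar>) < (\<Sum>i\<in>(UNIV::'n set). \<delta>)"
        by (intro sum_strict_mono) auto
      also have "\<dots> = e" by (simp add: \<delta>_def)
      finally have "norm (?z - y) < e" using norm_le_l1_cart[of "?z - y"] by simp
      then have "?z \<in> ball y e" by (simp add: dist_norm norm_minus_commute)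
      then show "\<omega> \<in> (\<lambda>\<omega>. \<chi> i. X i \<omega> + \<epsilon> i \<omega>) -` U \<inter> space M"
        using e \<omega> by (auto simp: C_def)
    qed
  qed
  finally show "emeasure M ((\<lambda>\<omega>. \<chi> i. X i \<omega> + \<epsilon> i \<omega>) -` U \<inter> space M) > 0"
    by (simp add: emeasure_eq_measure)
qed

end

section \<open>From the noise model to the conditioning formulas\<close>

lemma joint_normal_law_obs:
  assumes "joint_normal_law M Y G mY mG SYY SYG SGY SGG"
  shows "normal_rv M (\<lambda>\<omega>. \<Sum>i\<in>UNIV. a $ i * Y \<omega> $ i) (a \<bullet> mY) (a \<bullet> (SYY *v a))"
  using gaussian_family_sum[OF assms[unfolded joint_normal_law_def],
      of "\<lambda>p. case p of Inl i \<Rightarrow> a $ i | Inr _ \<Rightarrow> 0"]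
  by (simp add: sum_UNIV_sum inner_vec_def matrix_vector_mult_def sum_distrib_left mult_ac)

text \<open>The noise supplies both inputs of the regression: coercivity yields the invertibility of
  \<open>SYY\<close>, and full support of the observations turns versions into values at
  points.\<close>

lemma gaussian_conditioning_noisy_obs:
  fixes x :: "'n::finite \<Rightarrow> real" and G :: "'a \<Rightarrow> real^'d"
  assumes M: "prob_space M" and v: "v > 0"
    and points: "\<And>i. x i \<in> {t0..t1}"
    and noise: "gaussian_noise M \<epsilon> v (eval_points r t0 t1) (case_prod f)"
    and law: "joint_normal_law M (noisy_obs f \<epsilon> x) G mY mG SYY SYG SGY SGG"
  shows "coercive v SYY"
    and "cond_mean M (noisy_obs f \<epsilon> x) G = (\<lambda>y. mG + (SGY ** matrix_inv SYY) *v (y - mY))"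
    and "cond_cov M (noisy_obs f \<epsilon> x) G = (\<lambda>y. SGG - SGY ** matrix_inv SYY ** SYG)"
proof -
  interpret prob_space M by (rule M)
  interpret noisy_observation M "\<lambda>i. f 0 (x i)" \<epsilon> v "eval_points r t0 t1" "case_prod f" "\<lambda>i. (0, x i)"
    using noise v points by unfold_locales (auto simp: eval_points_def)
  show coercive: "coercive v SYY"
    using joint_normal_law_obs[OF law] by (intro coercive_covariance) (simp add: noisy_obs_def)
  interpret gaussian_regression M "noisy_obs f \<epsilon> x" G mY mG SYY SYG SGY SGG
    using law coercive_invertible[OF coercive v] by unfold_locales
  have supp: "full_support M (noisy_obs f \<epsilon> x)"
    using full_support_obs by (simp add: noisy_obs_def[abs_def])
  show "cond_mean M (noisy_obs f \<epsilon> x) G = (\<lambda>y. mG + (SGY ** matrix_inv SYY) *v (y - mY))"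
    and "cond_cov M (noisy_obs f \<epsilon> x) G = (\<lambda>y. SGG - SGY ** matrix_inv SYY ** SYG)"
    using cond_mean_eq[OF supp] cond_cov_eq[OF supp] by (simp_all add: gain_def)
qed

theorem proposition3:
  fixes M :: "'a measure" and N :: "nat \<Rightarrow> 'b measure"
    and r :: nat and t0 t1 :: real
    and \<mu> :: "real \<Rightarrow> real" and C :: "'h \<Rightarrow> real \<Rightarrow> real \<Rightarrow> real"
    and \<theta> :: 'h and \<sigma> :: real
    and \<mu>\<kappa> :: "nat \<Rightarrow> real" and \<Sigma>\<kappa> :: "nat \<Rightarrow> nat \<Rightarrow> real"
    and \<kappa> :: "nat \<Rightarrow> 'a \<Rightarrow> real" and f :: "int \<Rightarrow> real \<Rightarrow> 'a \<Rightarrow> real"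
    and x :: "'n::finite \<Rightarrow> real" and \<epsilon> :: "'n \<Rightarrow> 'a \<Rightarrow> real"
    and J :: "'d::finite \<Rightarrow> (int \<times> real) set" and c :: "'d \<Rightarrow> int \<times> real \<Rightarrow> real"
    and f' :: "nat \<Rightarrow> int \<Rightarrow> real \<Rightarrow> 'b \<Rightarrow> real" and \<epsilon>' :: "nat \<Rightarrow> 'n \<Rightarrow> 'b \<Rightarrow> real"
    and Y :: "'a \<Rightarrow> real^'n" and G :: "'a \<Rightarrow> real^'d"
    and Y' :: "nat \<Rightarrow> 'b \<Rightarrow> real^'n" and G' :: "nat \<Rightarrow> 'b \<Rightarrow> real^'d"
    and \<mu>Y :: "real^'n" and \<mu>G :: "real^'d"
    and \<Sigma>YY :: "real^'n^'n" and \<Sigma>YG :: "real^'d^'n" and \<Sigma>GY :: "real^'n^'d" and \<Sigma>GG :: "real^'d^'d"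
    and \<mu>Y' :: "nat \<Rightarrow> real^'n" and \<mu>G' :: "nat \<Rightarrow> real^'d"
    and \<Sigma>YY' :: "nat \<Rightarrow> real^'n^'n" and \<Sigma>YG' :: "nat \<Rightarrow> real^'d^'n"
    and \<Sigma>GY' :: "nat \<Rightarrow> real^'n^'d" and \<Sigma>GG' :: "nat \<Rightarrow> real^'d^'d"
  assumes noise_pos: "\<sigma>\<^sup>2 > 0"
    and points: "\<And>i. x i \<in> {t0..t1}"
    and evals: "\<And>k. finite (J k)" "\<And>k. J k \<subseteq> eval_points r t0 t1"
    \<comment> \<open>exact model\<close>
    and ensemble: "gaussian_differential_ensemble M r t0 t1 \<mu> (C \<theta>) \<mu>\<kappa> \<Sigma>\<kappa> \<kappa> f"
    and noise: "gaussian_noise M \<epsilon> (\<sigma>\<^sup>2) (eval_points r t0 t1) (case_prod f)"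
    and Y: "Y = noisy_obs f \<epsilon> x"
    and G: "G = lin_evals f J c"
    and law: "joint_normal_law M Y G \<mu>Y \<mu>G \<Sigma>YY \<Sigma>YG \<Sigma>GY \<Sigma>GG"
    \<comment> \<open>approximate models\<close>
    and prob': "\<And>l. prob_space (N l)"
    and ensemble': "\<And>l. jointly_gaussian (N l) (eval_points r t0 t1) (case_prod (f' l))"
    and noise': "\<And>l. gaussian_noise (N l) (\<epsilon>' l) (\<sigma>\<^sup>2) (eval_points r t0 t1) (case_prod (f' l))"
    and Y': "\<And>l. Y' l = noisy_obs (f' l) (\<epsilon>' l) x"
    and G': "\<And>l. G' l = lin_evals (f' l) J c"
    and law': "\<And>l. joint_normal_law (N l) (Y' l) (G' l)
                  (\<mu>Y' l) (\<mu>G' l) (\<Sigma>YY' l) (\<Sigma>YG' l) (\<Sigma>GY' l) (\<Sigma>GG' l)"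
    and lim_mean: "\<mu>Y' \<longlonglongrightarrow> \<mu>Y" "\<mu>G' \<longlonglongrightarrow> \<mu>G"
    and lim_cov: "\<Sigma>YY' \<longlonglongrightarrow> \<Sigma>YY" "\<Sigma>YG' \<longlonglongrightarrow> \<Sigma>YG" "\<Sigma>GY' \<longlonglongrightarrow> \<Sigma>GY" "\<Sigma>GG' \<longlonglongrightarrow> \<Sigma>GG"
  shows "\<forall>y :: real^'n.
    (\<lambda>l. cond_mean (N l) (Y' l) (G' l) y) \<longlonglongrightarrow> \<mu>G + (\<Sigma>GY ** matrix_inv \<Sigma>YY) *v (y - \<mu>Y) \<and>
    (\<lambda>l. cond_cov (N l) (Y' l) (G' l) y) \<longlonglongrightarrow> \<Sigma>GG - \<Sigma>GY ** matrix_inv \<Sigma>YY ** \<Sigma>YG"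
proof
  fix y :: "real^'n"
  note law'' = law'[unfolded Y']
  note cond = gaussian_conditioning_noisy_obs[OF prob' noise_pos points noise' law'']
  \<comment> \<open>The coercivity constant is the noise variance \<open>\<sigma>\<^sup>2\<close>,
    the same for every \<open>l\<close>; this uniformity is what convergence of the inverses rests
    on.\<close>
  have inv: "(\<lambda>l. matrix_inv (\<Sigma>YY' l)) \<longlonglongrightarrow> matrix_inv \<Sigma>YY"
    by (rule tendsto_matrix_inv_coercive[OF cond(1) noise_pos lim_cov(1)])
  have "(\<lambda>l. \<mu>G' l + (\<Sigma>GY' l ** matrix_inv (\<Sigma>YY' l)) *v (y - \<mu>Y' l))
      \<longlonglongrightarrow> \<mu>G + (\<Sigma>GY ** matrix_inv \<Sigma>YY) *v (y - \<mu>Y)"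
    by (intro tendsto_add tendsto_diff tendsto_matrix_mult tendsto_matrix_vector_mult inv lim_mean lim_cov tendsto_const)
  moreover have "(\<lambda>l. \<Sigma>GG' l - \<Sigma>GY' l ** matrix_inv (\<Sigma>YY' l) ** \<Sigma>YG' l)
      \<longlonglongrightarrow> \<Sigma>GG - \<Sigma>GY ** matrix_inv \<Sigma>YY ** \<Sigma>YG"
    by (intro tendsto_diff tendsto_matrix_mult inv lim_cov)
  ultimately show "(\<lambda>l. cond_mean (N l) (Y' l) (G' l) y) \<longlonglongrightarrow> \<mu>G + (\<Sigma>GY ** matrix_inv \<Sigma>YY) *v (y - \<mu>Y) \<and>
    (\<lambda>l. cond_cov (N l) (Y' l) (G' l) y) \<longlonglongrightarrow> \<Sigma>GG - \<Sigma>GY ** matrix_inv \<Sigma>YY ** \<Sigma>YG"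
    unfolding Y' cond(2,3) ..
qed

end
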